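(* Let $k$ be a field (of arbitrary characteristic), let $R=k[x_1,\dots,x_n]$ be the ring of polynomials in a finite number of variables over $k$, let $\mathcal D$ be the ring of $k$-linear differential operators of $R$, and let $0\neq f\in R$. Then $R_f$, with its natural $\mathcal D$-module structure, has finite length in the category of $\mathcal D$-modules.
   Context: For $t\geq 0$ and $1\leq i\leq n$, $D_{t,i}=\frac{1}{t!}\frac{\partial^t}{\partial x_i^t}:R\to R$ denotes the $k[x_1,\dots,x_{i-1},x_{i+1},\dots,x_n]$-linear map sending $x_i^v$ to $\binom{v}{t}x_i^{v-t}$ for all $v\geq 0$ (this is $0$ if $v<t$, and $D_{0,i}$ is the identity); it makes sense in every characteristic because $\binom vt$ is an integer. View $R$ as a subring of $\mathrm{End}_k R$ (elements acting by multiplication). The ring $\mathcal D$ of $k$-linear differential operators of $R$ is the $k$-subalgebra of $\mathrm{End}_kR$ generated by $R$ and all the $D_{t,i}$. $\mathcal D$-modules are left $\mathcal D$-modules. $R_f$ is the localization of $R$ at the powers of $f$; the natural action of $\mathcal D$ on $R$ extends to $R_f$ (with $R$ acting by multiplication), the action of $D_{t,i}$ being determined by induction on $t$ by $$D_{t,i}\left(\frac{m}{f^j}\right)=f^{-j}\cdot D_{t,i}(m)-\sum_{s=1}^{t}f^{-j}\cdot D_{s,i}(f^j)\cdot D_{t-s,i}\left(\frac{m}{f^j}\right),\qquad m\in R,\ j\geq 0,$$ with $D_{0,i}$ the identity. *)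

theory Defs
  imports
    "HOL-Library.Poly_Mapping"
    "HOL-Library.FuncSet"
    "HOL-Computational_Algebra.Fraction_Field"
    "HOL-Algebra.Module"
    "HOL-Algebra.Generated_Rings"
begin

section \<open>The polynomial ring and its differential operators\<close>

text \<open>
  Monomials are finitely supported exponent vectors \<open>nat \<Rightarrow>\<^sub>0 nat\<close>.  The type \<open>'k mpol\<close> has
  the countably many variables \<open>x\<^sub>0, x\<^sub>1, \<dots>\<close>; the ring \<open>R = k[x\<^sub>0, \<dots>, x\<^sub>n\<^sub>-\<^sub>1]\<close> is the subset
  \<open>polys n\<close>, so that \<open>n\<close> is an arbitrary natural number (\<open>n = 0\<close> included) and the
  variables are indexed by \<open>i < n\<close>.
\<close>

type_synonym 'k mpol = "(nat \<Rightarrow>\<^sub>0 nat) \<Rightarrow>\<^sub>0 'k"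

definition polys :: "nat \<Rightarrow> 'k::field mpol set" where
  "polys n = {p. \<forall>m \<in> Poly_Mapping.keys p. Poly_Mapping.keys m \<subseteq> {..<n}}"

abbreviation Const :: "'k::field \<Rightarrow> 'k mpol" where
  "Const c \<equiv> Poly_Mapping.single 0 c"

abbreviation Var :: "nat \<Rightarrow> 'k::field mpol" where
  "Var i \<equiv> Poly_Mapping.single (Poly_Mapping.single i 1) 1"

text \<open>
  The ring \<open>End\<^sub>k R\<close>.  As usual for functions on a carrier set, its elements are
  extensional (\<open>undefined\<close> outside \<open>R\<close>), so that equal operators on \<open>R\<close> are equal functions.
\<close>

definition End_polys :: "nat \<Rightarrow> ('k::field mpol \<Rightarrow> 'k mpol) ring" where
  "End_polys n =
    \<lparr>carrier = {\<phi> \<in> polys n \<rightarrow>\<^sub>E polys n.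
        (\<forall>p \<in> polys n. \<forall>q \<in> polys n. \<phi> (p + q) = \<phi> p + \<phi> q) \<and>
        (\<forall>c. \<forall>p \<in> polys n. \<phi> (Const c * p) = Const c * \<phi> p)},
     mult = compose (polys n),
     one = (\<lambda>p \<in> polys n. p),
     zero = (\<lambda>p \<in> polys n. 0),
     add = (\<lambda>\<phi> \<psi>. \<lambda>p \<in> polys n. \<phi> p + \<psi> p)\<rparr>"

definition mult_op :: "nat \<Rightarrow> 'k::field mpol \<Rightarrow> 'k mpol \<Rightarrow> 'k mpol" where
  "mult_op n r = (\<lambda>p \<in> polys n. r * p)"

text \<open>
  \<open>deriv_op n t i\<close> is \<open>D\<^sub>t\<^sub>,\<^sub>i\<close>, written out on the monomials of \<open>p\<close>.  Subtraction of exponent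
  vectors is truncated, but where truncation occurs the binomial coefficient vanishes.
\<close>

definition hasse_deriv :: "nat \<Rightarrow> nat \<Rightarrow> 'k::field mpol \<Rightarrow> 'k mpol" where
  "hasse_deriv t i p =
    (\<Sum>m \<in> Poly_Mapping.keys p.
       Poly_Mapping.single (m - Poly_Mapping.single i t)
         (of_nat (Poly_Mapping.lookup m i choose t) * Poly_Mapping.lookup p m))"

definition deriv_op :: "nat \<Rightarrow> nat \<Rightarrow> nat \<Rightarrow> 'k::field mpol \<Rightarrow> 'k mpol" where
  "deriv_op n t i = (\<lambda>p \<in> polys n. hasse_deriv t i p)"

text \<open>
  The ring \<open>\<D>\<close>.  Its generators include the multiplications by constants, hence the
  subring they generate is the \<open>k\<close>-subalgebra they generate.
\<close>

definition diff_ops :: "nat \<Rightarrow> ('k::field mpol \<Rightarrow> 'k mpol) ring" where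
  "diff_ops n =
    (End_polys n)\<lparr>carrier := generate_ring (End_polys n)
        (mult_op n ` polys n \<union> {deriv_op n t i | t i. i < n})\<rparr>"

subsection \<open>The operators \<open>D\<^sub>t\<^sub>,\<^sub>i\<close> satisfy their defining properties\<close>

lemma hasse_deriv_superset:
  assumes "finite A" "Poly_Mapping.keys p \<subseteq> A"
  shows "hasse_deriv t i p =
    (\<Sum>m \<in> A. Poly_Mapping.single (m - Poly_Mapping.single i t)
         (of_nat (Poly_Mapping.lookup m i choose t) * Poly_Mapping.lookup p m))"
  unfolding hasse_deriv_def using assms
  by (intro sum.mono_neutral_left) (auto simp: in_keys_iff)

lemma hasse_deriv_add: "hasse_deriv t i (p + q) = hasse_deriv t i p + hasse_deriv t i q"
proof -
  let ?A = "Poly_Mapping.keys p \<union> Poly_Mapping.keys q"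
  have "Poly_Mapping.keys (p + q) \<subseteq> ?A" by (rule Poly_Mapping.keys_add)
  then show ?thesis
    by (simp add: hasse_deriv_superset[of ?A] lookup_add distrib_left single_add sum.distrib)
qed

lemma hasse_deriv_single:
  "hasse_deriv t i (Poly_Mapping.single m c) =
    Poly_Mapping.single (m - Poly_Mapping.single i t)
      (of_nat (Poly_Mapping.lookup m i choose t) * c)"
  by (simp add: hasse_deriv_superset[of "{m}"])

lemma poly_mapping_sum_single:
  "(\<Sum>m\<in>Poly_Mapping.keys p. Poly_Mapping.single m (Poly_Mapping.lookup p m)) = p"
  by (rule poly_mapping_eqI)
     (auto simp: lookup_sum lookup_single when_def in_keys_iff if_distrib sum.delta cong: if_cong)

lemma hasse_deriv_0: "hasse_deriv 0 i p = p"
  by (simp add: hasse_deriv_def poly_mapping_sum_single)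

lemma Var_power: "(Var i :: 'k::field mpol) ^ v = Poly_Mapping.single (Poly_Mapping.single i v) 1"
proof (induction v)
  case (Suc v)
  have "(Var i :: 'k mpol) ^ Suc v = Var i * Poly_Mapping.single (Poly_Mapping.single i v) 1"
    by (simp only: power_Suc Suc)
  also have "\<dots> = Poly_Mapping.single (Poly_Mapping.single i (Suc v)) 1"
    by (simp only: mult_single single_add[symmetric]) simp
  finally show ?case .
qed simp

lemma hasse_deriv_Var_power:
  "hasse_deriv t i (Var i ^ v) = Const (of_nat (v choose t)) * Var i ^ (v - t)"
  unfolding Var_power by (simp add: hasse_deriv_single mult_single single_diff[symmetric] del: single_of_nat)

lemma hasse_deriv_sum:
  "hasse_deriv t i (sum g A) = (\<Sum>x\<in>A. hasse_deriv t i (g x))"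
  by (induction A rule: infinite_finite_induct)
     (simp_all add: hasse_deriv_add, simp_all add: hasse_deriv_def)

lemma hasse_deriv_single_mult_single:
  assumes "Poly_Mapping.lookup m i = 0"
  shows "hasse_deriv t i (Poly_Mapping.single m c * Poly_Mapping.single k v) =
         Poly_Mapping.single m c * hasse_deriv t i (Poly_Mapping.single k v)"
proof -
  have "m + k - Poly_Mapping.single i t = m + (k - Poly_Mapping.single i t)"
    using assms
    by (intro poly_mapping_eqI) (auto simp: lookup_add lookup_minus lookup_single when_def)
  with assms show ?thesis
    by (simp add: mult_single hasse_deriv_single lookup_add ac_simps)
qed

text \<open>Linearity over the polynomials in the remaining variables:\<close>

lemma hasse_deriv_linear:
  assumes "\<forall>m \<in> Poly_Mapping.keys r. i \<notin> Poly_Mapping.keys m"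
  shows "hasse_deriv t i (r * p) = r * hasse_deriv t i p"
proof -
  let ?s = "\<lambda>p m. Poly_Mapping.single m (Poly_Mapping.lookup p m)"
  let ?r = "\<Sum>m\<in>Poly_Mapping.keys r. ?s r m" and ?p = "\<Sum>m\<in>Poly_Mapping.keys p. ?s p m"
  have "hasse_deriv t i (?r * ?p) = ?r * hasse_deriv t i ?p"
    unfolding sum_distrib_right hasse_deriv_sum unfolding sum_distrib_left hasse_deriv_sum
    using assms by (intro sum.cong refl hasse_deriv_single_mult_single) (auto simp: in_keys_iff)
  then show ?thesis by (simp only: poly_mapping_sum_single)
qed

lemma polys_mult:
  assumes p: "p \<in> polys n" and q: "q \<in> polys n"
  shows "p * q \<in> polys n"
proof -
  have "Poly_Mapping.keys m \<subseteq> {..<n}" if m: "m \<in> Poly_Mapping.keys (p * q)" for m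
  proof -
    from m Poly_Mapping.keys_mult[of p q]
    obtain a b where ab: "m = a + b" "a \<in> Poly_Mapping.keys p" "b \<in> Poly_Mapping.keys q"
      by blast
    then show ?thesis
      using p q Poly_Mapping.keys_add[of a b] unfolding polys_def by blast
  qed
  then show ?thesis by (simp add: polys_def)
qed

lemma polys_add: "p \<in> polys n \<Longrightarrow> q \<in> polys n \<Longrightarrow> p + q \<in> polys n"
  using Poly_Mapping.keys_add[of p q] unfolding polys_def by blast

lemma polys_sum: "(\<And>x. x \<in> A \<Longrightarrow> g x \<in> polys n) \<Longrightarrow> sum g A \<in> polys n"
  by (induction A rule: infinite_finite_induct)
     (simp_all add: polys_add, simp_all add: polys_def)

lemma polys_Const: "Const c \<in> polys n"
  by (simp add: polys_def)

lemma hasse_deriv_polys: "p \<in> polys n \<Longrightarrow> hasse_deriv t i p \<in> polys n"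
  unfolding hasse_deriv_def
proof (intro polys_sum)
  fix m
  assume "p \<in> polys n" "m \<in> Poly_Mapping.keys p"
  moreover have "Poly_Mapping.keys (m - Poly_Mapping.single i t) \<subseteq> Poly_Mapping.keys m"
    by (auto simp: in_keys_iff lookup_minus)
  ultimately show "Poly_Mapping.single (m - Poly_Mapping.single i t)
      (of_nat (Poly_Mapping.lookup m i choose t) * Poly_Mapping.lookup p m) \<in> polys n"
    by (auto simp: polys_def)
qed

lemma mult_op_End: "r \<in> polys n \<Longrightarrow> mult_op n r \<in> carrier (End_polys n)"
  by (auto simp: End_polys_def mult_op_def polys_mult polys_add polys_Const algebra_simps)

lemma deriv_op_End: "deriv_op n t i \<in> carrier (End_polys n)"
proof -
  have "hasse_deriv t i (Const c * p) = Const c * hasse_deriv t i p" for c and p :: "'a mpol"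
    by (rule hasse_deriv_linear) simp
  then show ?thesis
    by (auto simp: End_polys_def deriv_op_def polys_mult polys_add polys_Const
        hasse_deriv_polys hasse_deriv_add)
qed

section \<open>Left modules of finite length\<close>

text \<open>The locale \<open>module\<close> of \<open>HOL-Algebra\<close> requires commutative scalars.\<close>

locale left_module = R?: ring R + M?: abelian_group M
  for R :: "('a, 'c) ring_scheme" and M :: "('a, 'b, 'd) module_scheme" (structure) +
  assumes smult_closed:
      "\<lbrakk>a \<in> carrier R; x \<in> carrier M\<rbrakk> \<Longrightarrow> a \<odot>\<^bsub>M\<^esub> x \<in> carrier M"
    and smult_l_distr:
      "\<lbrakk>a \<in> carrier R; b \<in> carrier R; x \<in> carrier M\<rbrakk> \<Longrightarrow>
        (a \<oplus>\<^bsub>R\<^esub> b) \<odot>\<^bsub>M\<^esub> x = a \<odot>\<^bsub>M\<^esub> x \<oplus>\<^bsub>M\<^esub> b \<odot>\<^bsub>M\<^esub> x"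
    and smult_r_distr:
      "\<lbrakk>a \<in> carrier R; x \<in> carrier M; y \<in> carrier M\<rbrakk> \<Longrightarrow>
        a \<odot>\<^bsub>M\<^esub> (x \<oplus>\<^bsub>M\<^esub> y) = a \<odot>\<^bsub>M\<^esub> x \<oplus>\<^bsub>M\<^esub> a \<odot>\<^bsub>M\<^esub> y"
    and smult_assoc:
      "\<lbrakk>a \<in> carrier R; b \<in> carrier R; x \<in> carrier M\<rbrakk> \<Longrightarrow>
        (a \<otimes>\<^bsub>R\<^esub> b) \<odot>\<^bsub>M\<^esub> x = a \<odot>\<^bsub>M\<^esub> (b \<odot>\<^bsub>M\<^esub> x)"
    and smult_one: "x \<in> carrier M \<Longrightarrow> \<one>\<^bsub>R\<^esub> \<odot>\<^bsub>M\<^esub> x = x"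

text \<open>
  A composition series is a finite strictly increasing chain of submodules from \<open>0\<close> to \<open>M\<close>
  in which no further submodule can be inserted, i.e. whose successive quotients are simple.
  The predicate \<open>submodule\<close> of \<open>HOL-Algebra\<close> does not require commutative scalars.
\<close>

definition composition_series ::
    "('a, 'c) ring_scheme \<Rightarrow> ('a, 'b, 'd) module_scheme \<Rightarrow> nat \<Rightarrow> (nat \<Rightarrow> 'b set) \<Rightarrow> bool" where
  "composition_series R M l N \<longleftrightarrow>
     N 0 = {\<zero>\<^bsub>M\<^esub>} \<and> N l = carrier M \<and>
     (\<forall>i \<le> l. submodule (N i) R M) \<and>
     (\<forall>i < l. N i \<subset> N (Suc i) \<and>
        (\<forall>L. submodule L R M \<longrightarrow> N i \<subseteq> L \<longrightarrow> L \<subseteq> N (Suc i) \<longrightarrow> L = N i \<or> L = N (Suc i)))"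

definition finite_length ::
    "('a, 'c) ring_scheme \<Rightarrow> ('a, 'b, 'd) module_scheme \<Rightarrow> bool" where
  "finite_length R M \<longleftrightarrow> (\<exists>l N. composition_series R M l N)"

section \<open>The localization \<open>R\<^sub>f\<close> and its natural \<open>\<D>\<close>-module structure\<close>

text \<open>
  As \<open>R\<close> is a domain and \<open>f \<noteq> 0\<close>, \<open>R\<^sub>f\<close> is the subring \<open>{m/f^j}\<close> of a fraction field.
  The structure \<open>loc_module n f act\<close> is \<open>R\<^sub>f\<close> with the operators \<open>P\<close> acting by \<open>act P\<close>.
\<close>

definition localization :: "nat \<Rightarrow> 'k::field mpol \<Rightarrow> 'k mpol fract set" where
  "localization n f = {Fraction_Field.Fract m (f ^ j) | m j. m \<in> polys n}"

definition loc_module ::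
    "nat \<Rightarrow> 'k::field mpol \<Rightarrow> (('k mpol \<Rightarrow> 'k mpol) \<Rightarrow> 'k mpol fract \<Rightarrow> 'k mpol fract) \<Rightarrow>
      ('k mpol \<Rightarrow> 'k mpol, 'k mpol fract) module" where
  "loc_module n f act =
    \<lparr>carrier = localization n f, mult = (*), one = 1, zero = 0, add = (+), smult = act\<rparr>"

text \<open>
  The natural action: \<open>R\<close> acts by multiplication and \<open>D\<^sub>t\<^sub>,\<^sub>i\<close> by the recursion on \<open>t\<close> coming
  from the Leibniz rule for \<open>D\<^sub>t\<^sub>,\<^sub>i (f^j \<cdot> m/f^j)\<close>.  As these operators generate \<open>\<D>\<close>, at
  most one module structure satisfies this.  The case \<open>j = 0\<close> says that it extends the
  action on \<open>R\<close>.
\<close>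

definition natural_action ::
    "nat \<Rightarrow> 'k::field mpol \<Rightarrow> (('k mpol \<Rightarrow> 'k mpol) \<Rightarrow> 'k mpol fract \<Rightarrow> 'k mpol fract) \<Rightarrow> bool"
  where
  "natural_action n f act \<longleftrightarrow>
     left_module (diff_ops n) (loc_module n f act) \<and>
     (\<forall>r \<in> polys n. \<forall>z \<in> localization n f. act (mult_op n r) z = Fraction_Field.Fract r 1 * z) \<and>
     (\<forall>t. \<forall>i < n. \<forall>m \<in> polys n. \<forall>j.
        act (deriv_op n t i) (Fraction_Field.Fract m (f ^ j)) =
          Fraction_Field.Fract 1 (f ^ j) * Fraction_Field.Fract (deriv_op n t i m) 1
          - (\<Sum>s = 1..t. Fraction_Field.Fract 1 (f ^ j) * Fraction_Field.Fract (deriv_op n s i (f ^ j)) 1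
                         * act (deriv_op n (t - s) i) (Fraction_Field.Fract m (f ^ j))))"

end

theory Submission
  imports Defs "HOL-Computational_Algebra.Formal_Power_Series"
begin

text \<open>
  The reason for finite length is a comparison of growth rates: a non-zero \<open>\<D>\<close>-module with
  a compatible filtration grows at least like \<open>s^n\<close>, a form of Bernstein's inequality.  As \<open>R\<^sub>f\<close> carries a filtration that grows no faster than a multiple of \<open>s^n\<close>, it has room
  for a bounded number of non-zero subquotients only, and a chain of submodules of maximal
  length is a composition series (\<open>finite_length_if_chains_bounded\<close>).

  \<^emph>\<open>Upper bound.\<close>  If \<open>f\<close> has degree at most \<open>d\<close>, put
  \<open>M\<^sub>s = {m / f^s | deg m \<le> s (d + 1)}\<close>.  Multiplication by a variable maps \<open>M\<^sub>s\<close> to \<open>M\<^sub>s\<^sub>+\<^sub>1\<close>,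
  and \<open>D\<^sub>t\<^sub>,\<^sub>i\<close> maps \<open>M\<^sub>s\<close> to \<open>M\<^sub>s\<^sub>+\<^sub>t\<close>, since it raises the order of the pole by at most \<open>t\<close>
  and the degree of the numerator by at most \<open>t d\<close> (\<open>pole_filtration\<close>).  Counting monomials
  bounds the dimension of \<open>M\<^sub>s\<close> by \<open>(s (d + 1) + 1)^n\<close>.

  \<^emph>\<open>Lower bound.\<close>  Let \<open>N \<subset> N'\<close> be submodules and let \<open>L\<^sub>s\<close> be \<open>N' \<inter> M\<^sub>r\<^sub>+\<^sub>s\<close>, with \<open>r\<close> so large
  that \<open>L\<^sub>0\<close> is not contained in \<open>N\<close>.  A non-zero combination \<open>P\<close> of operators \<open>x^a D^t\<close> with
  \<open>\<bar>a\<bar> + \<bar>t\<bar> \<le> s\<close> cannot map \<open>L\<^sub>s\<close> into \<open>N\<close> (\<open>no_annihilating_operator\<close>): commutators with the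
  variables would lower \<open>P\<close> to a non-zero polynomial, and Hasse derivatives would lower that
  polynomial to a non-zero constant, at the cost of replacing \<open>s\<close> by smaller numbers.  This
  is where divided powers make the argument independent of the characteristic: the
  commutator of \<open>D\<^sub>t\<^sub>,\<^sub>i\<close> with \<open>x\<^sub>i\<close> is \<open>D\<^sub>t\<^sub>-\<^sub>1\<^sub>,\<^sub>i\<close> without a factor \<open>t\<close>, and \<open>D\<^sub>t\<^sub>,\<^sub>i\<close> maps
  \<open>x\<^sub>i^t\<close> to \<open>1\<close> instead of \<open>t!\<close>.  So the operators \<open>P\<close> embed into the linear maps
  \<open>L\<^sub>s/(N \<inter> L\<^sub>s) \<rightarrow> L\<^sub>2\<^sub>s/(N \<inter> L\<^sub>2\<^sub>s)\<close>.  There are at least \<open>(q + 1)^(2 n)\<close> monomials \<open>x^a D^t\<close> if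
  \<open>s = 2 n q\<close>, hence one of the two quotients has dimension at least \<open>(q + 1)^n\<close>
  (\<open>relative_growth\<close>).  Comparing both bounds for a suitable \<open>q\<close> bounds the length of a chain
  (\<open>chain_length_bound\<close>).

  \<^emph>\<open>Existence of the action.\<close>  The Taylor expansion \<open>x\<^sub>i \<mapsto> x\<^sub>i + T\<close> is a ring homomorphism into
  power series over the fraction field, so it extends to fractions, and its coefficients
  extend the operators \<open>D\<^sub>t\<^sub>,\<^sub>i\<close> together with the Leibniz rule.  That every relation between
  these operators on \<open>R\<close> persists on \<open>R\<^sub>f\<close> follows from a uniqueness statement: the extended
  operators become zero under iterated commutators with \<open>f\<close>, and an operator of this kind
  that vanishes on \<open>R\<close> vanishes on \<open>R\<^sub>f\<close> (\<open>vanishes_on_localization\<close>).  Hence each element of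
  \<open>\<D>\<close> has exactly one such extension, and all module axioms hold by uniqueness.
\<close>

section \<open>The Leibniz rule for Hasse derivatives\<close>

lemma single_sum: "Poly_Mapping.single a (sum g S) = (\<Sum>s\<in>S. Poly_Mapping.single a (g s))"
  by (induction S rule: infinite_finite_induct) (simp_all add: single_add)

text \<open>
  On monomials the Leibniz rule is Vandermonde's identity for binomial coefficients.  If
  the truncated subtraction of exponents truncates in one of the two factors, then the
  corresponding binomial coefficient is zero.
\<close>

lemma hasse_deriv_mult_single:
  "hasse_deriv t i (Poly_Mapping.single m c * Poly_Mapping.single l d) =
    (\<Sum>s\<le>t. hasse_deriv s i (Poly_Mapping.single m c) *
      hasse_deriv (t - s) i (Poly_Mapping.single l d))"
proof -
  let ?M = "Poly_Mapping.lookup m i" and ?L = "Poly_Mapping.lookup l i"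
  let ?u = "m + l - Poly_Mapping.single i t"
  have "hasse_deriv s i (Poly_Mapping.single m c) * hasse_deriv (t - s) i (Poly_Mapping.single l d)
      = Poly_Mapping.single ?u (of_nat ((?M choose s) * (?L choose (t - s))) * (c * d))"
    if "s \<le> t" for s
  proof (cases "s \<le> ?M \<and> t - s \<le> ?L")
    case True
    then have "m - Poly_Mapping.single i s + (l - Poly_Mapping.single i (t - s)) = ?u"
      using that
      by (intro poly_mapping_eqI) (auto simp: lookup_add lookup_minus lookup_single when_def)
    then show ?thesis
      by (simp add: hasse_deriv_single mult_single ac_simps)
  next
    case False
    then have "(?M choose s) = 0 \<or> (?L choose (t - s)) = 0"
      by (auto simp: not_le binomial_eq_0)
    then show ?thesis
      by (elim disjE) (simp_all add: hasse_deriv_single mult_single binomial_eq_0)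
  qed
  then have "(\<Sum>s\<le>t. hasse_deriv s i (Poly_Mapping.single m c) *
      hasse_deriv (t - s) i (Poly_Mapping.single l d)) =
      Poly_Mapping.single ?u (of_nat (\<Sum>s\<le>t. (?M choose s) * (?L choose (t - s))) * (c * d))"
    unfolding of_nat_sum sum_distrib_right single_sum by (intro sum.cong) auto
  also have "\<dots> = hasse_deriv t i (Poly_Mapping.single m c * Poly_Mapping.single l d)"
    by (simp only: vandermonde mult_single hasse_deriv_single lookup_add)
  finally show ?thesis by simp
qed

lemma hasse_deriv_mult:
  "hasse_deriv t i (p * q) = (\<Sum>s\<le>t. hasse_deriv s i p * hasse_deriv (t - s) i q)"
proof -
  let ?s = "\<lambda>p m. Poly_Mapping.single m (Poly_Mapping.lookup p m)"
  let ?p = "\<Sum>m\<in>Poly_Mapping.keys p. ?s p m" and ?q = "\<Sum>m\<in>Poly_Mapping.keys q. ?s q m"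
  have "hasse_deriv t i (?p * ?q) = (\<Sum>m\<in>Poly_Mapping.keys p. \<Sum>l\<in>Poly_Mapping.keys q.
      \<Sum>s\<le>t. hasse_deriv s i (?s p m) * hasse_deriv (t - s) i (?s q l))"
    by (simp only: sum_product hasse_deriv_sum hasse_deriv_mult_single)
  also have "\<dots> = (\<Sum>m\<in>Poly_Mapping.keys p. \<Sum>s\<le>t. \<Sum>l\<in>Poly_Mapping.keys q.
      hasse_deriv s i (?s p m) * hasse_deriv (t - s) i (?s q l))"
    by (intro sum.cong refl sum.swap)
  also have "\<dots> = (\<Sum>s\<le>t. \<Sum>m\<in>Poly_Mapping.keys p. \<Sum>l\<in>Poly_Mapping.keys q.
      hasse_deriv s i (?s p m) * hasse_deriv (t - s) i (?s q l))"
    by (rule sum.swap)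
  also have "\<dots> = (\<Sum>s\<le>t. hasse_deriv s i ?p * hasse_deriv (t - s) i ?q)"
    by (simp only: sum_product hasse_deriv_sum)
  finally show ?thesis by (simp only: poly_mapping_sum_single)
qed

lemma hasse_deriv_one: "hasse_deriv t i 1 = (if t = 0 then 1 else 0)"
proof -
  have "hasse_deriv t i (Poly_Mapping.single 0 1) =
      (if t = 0 then Poly_Mapping.single 0 1 else (0 :: 'a mpol))"
    by (cases "t = 0") (simp_all add: hasse_deriv_single binomial_eq_0 del: single_one)
  then show ?thesis by simp
qed

section \<open>Taylor expansion of fractions\<close>

abbreviation frac_of :: "'k::field mpol \<Rightarrow> 'k mpol fract" where
  "frac_of p \<equiv> Fraction_Field.Fract p 1"

lemma frac_of_add: "frac_of (p + q) = frac_of p + frac_of q"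
  by simp

lemma frac_of_mult: "frac_of (p * q) = frac_of p * frac_of q"
  by simp

lemma frac_of_uminus: "frac_of (- p) = - frac_of p"
  by simp

lemma frac_of_zero: "frac_of 0 = 0"
  by (simp add: Zero_fract_def)

lemma frac_of_one: "frac_of 1 = 1"
  by (simp add: One_fract_def)

lemma frac_of_sum: "frac_of (sum g S) = (\<Sum>s\<in>S. frac_of (g s))"
  by (induction S rule: infinite_finite_induct) (simp_all add: frac_of_zero frac_of_add del: add_fract)

lemma frac_of_eq_0_iff: "frac_of p = 0 \<longleftrightarrow> p = 0"
  by (simp add: Zero_fract_def eq_fract)

text \<open>
  The expansion of \<open>p(\<dots>, x\<^sub>i + T, \<dots>)\<close> in powers of \<open>T\<close>.  Its coefficients are the Hasse
  derivatives, and the Leibniz rule says that it is multiplicative.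
\<close>

definition taylor_poly :: "nat \<Rightarrow> 'k::field mpol \<Rightarrow> 'k mpol fract fps" where
  "taylor_poly i p = Abs_fps (\<lambda>t. frac_of (hasse_deriv t i p))"

lemma taylor_poly_mult: "taylor_poly i (p * q) = taylor_poly i p * taylor_poly i q"
  by (rule fps_ext)
     (simp add: taylor_poly_def fps_mult_nth hasse_deriv_mult frac_of_sum atLeast0AtMost)

lemma taylor_poly_add: "taylor_poly i (p + q) = taylor_poly i p + taylor_poly i q"
  by (rule fps_ext) (simp add: taylor_poly_def hasse_deriv_add)

lemma taylor_poly_one: "taylor_poly i 1 = 1"
  by (rule fps_ext) (simp add: taylor_poly_def hasse_deriv_one frac_of_zero frac_of_one)

lemma taylor_poly_nth_0: "fps_nth (taylor_poly i p) 0 = frac_of p"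
  by (simp add: taylor_poly_def hasse_deriv_0)

lemma taylor_poly_nonzero: "p \<noteq> 0 \<Longrightarrow> fps_nth (taylor_poly i p) 0 \<noteq> 0"
  by (simp add: taylor_poly_nth_0 frac_of_eq_0_iff)

text \<open>
  The constant term of \<open>taylor_poly i b\<close> is \<open>b\<close>, so the expansion of a non-zero denominator is
  invertible and there is exactly one candidate for the expansion of \<open>a / b\<close>; it is
  characterised by the equation that avoids the division of power series.
\<close>

definition taylor :: "nat \<Rightarrow> 'k::field mpol fract \<Rightarrow> 'k mpol fract fps" where
  "taylor i z = (SOME w. \<exists>a b. b \<noteq> 0 \<and> z = Fraction_Field.Fract a b \<and>
     w * taylor_poly i b = taylor_poly i a)"

lemma taylor_poly_neq_0: "p \<noteq> 0 \<Longrightarrow> taylor_poly i p \<noteq> 0"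
  using taylor_poly_nonzero[of p i] by (metis fps_zero_nth)

lemma taylor_Fract:
  assumes "b \<noteq> 0"
  shows "taylor i (Fraction_Field.Fract a b) * taylor_poly i b = taylor_poly i a"
proof -
  let ?P = "\<lambda>w. \<exists>c d. d \<noteq> 0 \<and> Fraction_Field.Fract a b = Fraction_Field.Fract c d \<and>
     w * taylor_poly i d = taylor_poly i c"
  have "taylor_poly i a * inverse (taylor_poly i b) * taylor_poly i b = taylor_poly i a"
    by (simp only: mult.assoc inverse_mult_eq_1[OF taylor_poly_nonzero[OF assms]] mult_1_right)
  then have "?P (taylor_poly i a * inverse (taylor_poly i b))"
    using assms by blast
  then have "?P (taylor i (Fraction_Field.Fract a b))"
    unfolding taylor_def by (rule someI)
  then obtain c d where cd: "d \<noteq> 0" "Fraction_Field.Fract a b = Fraction_Field.Fract c d"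
      "taylor i (Fraction_Field.Fract a b) * taylor_poly i d = taylor_poly i c" by blast
  from cd assms have "a * d = c * b" by (simp add: eq_fract)
  then have "taylor_poly i a * taylor_poly i d = taylor_poly i c * taylor_poly i b"
    by (simp only: taylor_poly_mult[symmetric])
  then have "taylor_poly i d * (taylor i (Fraction_Field.Fract a b) * taylor_poly i b) =
      taylor_poly i d * taylor_poly i a"
    by (metis cd(3) mult.commute mult.left_commute)
  then show ?thesis
    using taylor_poly_neq_0[OF cd(1)] by simp
qed

lemma taylor_unique:
  assumes "b \<noteq> 0" "w * taylor_poly i b = taylor_poly i a"
  shows "taylor i (Fraction_Field.Fract a b) = w"
proof -
  have "taylor i (Fraction_Field.Fract a b) * taylor_poly i b = w * taylor_poly i b"
    using assms taylor_Fract by metis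
  then show ?thesis using taylor_poly_neq_0[OF assms(1)] by simp
qed

lemma taylor_frac_of: "taylor i (frac_of p) = taylor_poly i p"
  by (rule taylor_unique) (simp_all add: taylor_poly_one)

lemma taylor_mult: "taylor i (y * z) = taylor i y * taylor i z"
proof -
  obtain a b where y: "y = Fraction_Field.Fract a b" "b \<noteq> 0" by (cases y) auto
  obtain c d where z: "z = Fraction_Field.Fract c d" "d \<noteq> 0" by (cases z) auto
  have "taylor i y * taylor i z * taylor_poly i (b * d) =
      (taylor i y * taylor_poly i b) * (taylor i z * taylor_poly i d)"
    by (simp add: taylor_poly_mult ac_simps)
  also have "\<dots> = taylor_poly i (a * c)"
    unfolding y z by (simp only: taylor_Fract[OF y(2)] taylor_Fract[OF z(2)] taylor_poly_mult)
  finally have "taylor i (Fraction_Field.Fract (a * c) (b * d)) = taylor i y * taylor i z"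
    using y z by (intro taylor_unique) auto
  then show ?thesis using y z by simp
qed

lemma taylor_add: "taylor i (y + z) = taylor i y + taylor i z"
proof -
  obtain a b where y: "y = Fraction_Field.Fract a b" "b \<noteq> 0" by (cases y) auto
  obtain c d where z: "z = Fraction_Field.Fract c d" "d \<noteq> 0" by (cases z) auto
  have "(taylor i y + taylor i z) * taylor_poly i (b * d) =
      (taylor i y * taylor_poly i b) * taylor_poly i d + (taylor i z * taylor_poly i d) * taylor_poly i b"
    by (simp add: taylor_poly_mult algebra_simps)
  also have "\<dots> = taylor_poly i (a * d + c * b)"
    unfolding y z
    by (simp only: taylor_Fract[OF y(2)] taylor_Fract[OF z(2)] taylor_poly_mult taylor_poly_add)
  finally have "taylor i (Fraction_Field.Fract (a * d + c * b) (b * d)) = taylor i y + taylor i z"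
    using y z by (intro taylor_unique) auto
  then show ?thesis using y z by simp
qed

definition hasse_fract :: "nat \<Rightarrow> nat \<Rightarrow> 'k::field mpol fract \<Rightarrow> 'k mpol fract" where
  "hasse_fract t i z = fps_nth (taylor i z) t"

lemma hasse_fract_frac_of: "hasse_fract t i (frac_of p) = frac_of (hasse_deriv t i p)"
  by (simp add: hasse_fract_def taylor_frac_of taylor_poly_def)

lemma hasse_fract_add: "hasse_fract t i (y + z) = hasse_fract t i y + hasse_fract t i z"
  by (simp add: hasse_fract_def taylor_add)

lemma hasse_fract_mult:
  "hasse_fract t i (y * z) = (\<Sum>s\<le>t. hasse_fract s i y * hasse_fract (t - s) i z)"
  by (simp add: hasse_fract_def taylor_mult fps_mult_nth atLeast0AtMost)

lemma hasse_fract_0: "hasse_fract 0 i z = z"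
proof -
  obtain a b where z: "z = Fraction_Field.Fract a b" "b \<noteq> 0" by (cases z) auto
  have bz: "frac_of b * z = frac_of a" using z by (simp add: eq_fract)
  have "frac_of b * hasse_fract 0 i z = hasse_fract 0 i (frac_of b * z)"
    by (simp add: hasse_fract_mult hasse_fract_frac_of hasse_deriv_0)
  also have "\<dots> = frac_of b * z"
    unfolding bz by (simp only: hasse_fract_frac_of hasse_deriv_0)
  finally have "frac_of b * hasse_fract 0 i z = frac_of b * z" .
  moreover have "frac_of b \<noteq> 0" using z(2) frac_of_eq_0_iff by blast
  ultimately show ?thesis by (metis mult_left_cancel)
qed

lemma hasse_fract_zero: "hasse_fract t i 0 = 0"
  using hasse_fract_add[of t i 0 0] by (metis add.right_neutral add_left_imp_eq)

lemma hasse_deriv_Const: "hasse_deriv t i (Const c) = (if t = 0 then Const c else 0)"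
  by (auto simp: hasse_deriv_single binomial_eq_0)

lemma hasse_deriv_Var:
  "hasse_deriv t i (Var j) = (if t = 0 then Var j else if t = 1 \<and> i = j then 1 else 0)"
proof (cases "t = 0")
  case False
  show ?thesis
  proof (cases "i = j")
    case True
    then show ?thesis using False
      by (cases "t = 1") (auto simp: hasse_deriv_single binomial_eq_0)
  next
    case False
    then show ?thesis using \<open>t \<noteq> 0\<close>
      by (auto simp: hasse_deriv_single lookup_single when_def binomial_eq_0)
  qed
qed (simp add: hasse_deriv_0)

lemma hasse_fract_Const_mult:
  "hasse_fract t i (frac_of (Const c) * z) = frac_of (Const c) * hasse_fract t i z"
proof -
  have "hasse_fract t i (frac_of (Const c) * z) =
     (\<Sum>s\<le>t. if s = 0 then frac_of (Const c) * hasse_fract t i z else 0)"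
    unfolding hasse_fract_mult hasse_fract_frac_of hasse_deriv_Const
    by (intro sum.cong) (auto simp: frac_of_zero simp del: mult_fract)
  then show ?thesis by simp
qed

text \<open>
  In other words, the commutator of \<open>D\<^sub>t\<^sub>,\<^sub>i\<close> with \<open>x\<^sub>i\<close> is \<open>D\<^sub>t\<^sub>-\<^sub>1\<^sub>,\<^sub>i\<close>.  No factor \<open>t\<close> appears,
  which could be zero in positive characteristic.
\<close>

lemma hasse_fract_Var_mult:
  "hasse_fract t i (frac_of (Var j) * z) = frac_of (Var j) * hasse_fract t i z +
     (if i = j \<and> t > 0 then hasse_fract (t - 1) i z else 0)"
proof -
  let ?g = "\<lambda>s. frac_of (hasse_deriv s i (Var j)) * hasse_fract (t - s) i z"
  have eq: "hasse_fract t i (frac_of (Var j) * z) = sum ?g {..t}"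
    unfolding hasse_fract_mult hasse_fract_frac_of ..
  show ?thesis
  proof (cases "t = 0")
    case True
    then show ?thesis unfolding eq by (simp add: hasse_deriv_0)
  next
    case False
    have "sum ?g {..t} = sum ?g {0, 1}"
      using False by (intro sum.mono_neutral_right) (auto simp: hasse_deriv_Var frac_of_zero simp del: One_nat_def)
    also have "\<dots> = frac_of (Var j) * hasse_fract t i z +
       (if i = j then hasse_fract (t - 1) i z else 0)"
      by (simp add: hasse_deriv_Var frac_of_zero frac_of_one del: One_nat_def)
    finally show ?thesis unfolding eq using False by simp
  qed
qed

text \<open>
  The recursion that determines the natural action is the Leibniz rule for \<open>f^j \<cdot> (m / f^j)\<close>,
  solved for the summand in which the second factor is differentiated \<open>t\<close> times.
\<close>

lemma hasse_fract_recursion: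
  assumes "f \<noteq> 0"
  shows "hasse_fract t i (Fraction_Field.Fract m (f ^ j)) =
    Fraction_Field.Fract 1 (f ^ j) * frac_of (hasse_deriv t i m)
      - (\<Sum>s = 1..t. Fraction_Field.Fract 1 (f ^ j) * frac_of (hasse_deriv s i (f ^ j)) *
           hasse_fract (t - s) i (Fraction_Field.Fract m (f ^ j)))"
proof -
  let ?z = "Fraction_Field.Fract m (f ^ j)" and ?u = "Fraction_Field.Fract 1 (f ^ j)"
  let ?g = "\<lambda>s. frac_of (hasse_deriv s i (f ^ j)) * hasse_fract (t - s) i ?z"
  have u: "?u * frac_of (f ^ j) = 1"
    using assms by (simp add: One_fract_def eq_fract)
  have "frac_of (f ^ j) * ?z = frac_of m"
    using assms by (simp add: eq_fract)
  then have "frac_of (hasse_deriv t i m) = hasse_fract t i (frac_of (f ^ j) * ?z)"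
    by (simp only: hasse_fract_frac_of)
  also have "\<dots> = sum ?g {..t}"
    unfolding hasse_fract_mult hasse_fract_frac_of ..
  also have "{..t} = insert 0 {1..t}" by auto
  also have "sum ?g (insert 0 {1..t}) = frac_of (f ^ j) * hasse_fract t i ?z + sum ?g {1..t}"
    by (simp add: hasse_deriv_0)
  finally have "?u * frac_of (hasse_deriv t i m) =
      (?u * frac_of (f ^ j)) * hasse_fract t i ?z + ?u * sum ?g {1..t}"
    by (simp only: distrib_left mult.assoc)
  then show ?thesis
    unfolding u by (simp add: sum_distrib_left mult.assoc del: mult_fract)
qed

section \<open>Degrees of polynomials\<close>

text \<open>
  The sum runs over a fixed set of variables, rather than over the support of \<open>m\<close>, so that
  additivity is immediate.
\<close>

definition mdeg :: "nat \<Rightarrow> (nat \<Rightarrow>\<^sub>0 nat) \<Rightarrow> nat" where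
  "mdeg n m = (\<Sum>i<n. Poly_Mapping.lookup m i)"

lemma mdeg_add: "mdeg n (a + b) = mdeg n a + mdeg n b"
  by (simp add: mdeg_def lookup_add sum.distrib)

lemma mdeg_zero: "mdeg n 0 = 0"
  by (simp add: mdeg_def)

lemma mdeg_single: "i < n \<Longrightarrow> mdeg n (Poly_Mapping.single i t) = t"
  by (simp add: mdeg_def lookup_single when_def sum.delta)

lemma lookup_le_mdeg: "i < n \<Longrightarrow> Poly_Mapping.lookup m i \<le> mdeg n m"
  unfolding mdeg_def by (rule member_le_sum) auto

lemma minus_single_add_single:
  "t \<le> Poly_Mapping.lookup m i \<Longrightarrow> m - Poly_Mapping.single i t + Poly_Mapping.single i t = m"
  for m :: "nat \<Rightarrow>\<^sub>0 nat"
  by (rule poly_mapping_eqI) (auto simp: lookup_add lookup_minus lookup_single when_def)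

lemma mdeg_minus_single:
  assumes "i < n" "t \<le> Poly_Mapping.lookup m i"
  shows "mdeg n m = mdeg n (m - Poly_Mapping.single i t) + t"
  using mdeg_add[of n "m - Poly_Mapping.single i t" "Poly_Mapping.single i t"] assms
  by (simp add: minus_single_add_single mdeg_single)

definition polys_upto :: "nat \<Rightarrow> nat \<Rightarrow> 'k::field mpol set" where
  "polys_upto n d = {p \<in> polys n. \<forall>m \<in> Poly_Mapping.keys p. mdeg n m \<le> d}"

lemma polys_upto_polys: "p \<in> polys_upto n d \<Longrightarrow> p \<in> polys n"
  by (simp add: polys_upto_def)

lemma polys_upto_mono: "p \<in> polys_upto n d \<Longrightarrow> d \<le> e \<Longrightarrow> p \<in> polys_upto n e"
  by (force simp: polys_upto_def)

lemma polys_upto_add: "p \<in> polys_upto n d \<Longrightarrow> q \<in> polys_upto n d \<Longrightarrow> p + q \<in> polys_upto n d"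
  using Poly_Mapping.keys_add[of p q] polys_add[of p n q] unfolding polys_upto_def by blast

lemma zero_polys_upto: "0 \<in> polys_upto n d"
  by (simp add: polys_upto_def polys_def)

lemma Const_polys_upto: "Const c \<in> polys_upto n d"
  by (simp add: polys_upto_def polys_Const mdeg_zero)

lemma Var_polys_upto: "i < n \<Longrightarrow> Var i \<in> polys_upto n 1"
  by (simp add: polys_upto_def polys_def mdeg_single del: One_nat_def)

lemma polys_upto_mult:
  assumes "p \<in> polys_upto n d" "q \<in> polys_upto n e"
  shows "p * q \<in> polys_upto n (d + e)"
proof -
  have "mdeg n m \<le> d + e" if m: "m \<in> Poly_Mapping.keys (p * q)" for m
  proof -
    from m Poly_Mapping.keys_mult[of p q]
    obtain a b where ab: "m = a + b" "a \<in> Poly_Mapping.keys p" "b \<in> Poly_Mapping.keys q"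
      by blast
    then have "mdeg n a \<le> d" "mdeg n b \<le> e"
      using assms by (auto simp: polys_upto_def)
    then show ?thesis by (simp add: ab mdeg_add)
  qed
  then show ?thesis using assms polys_mult by (auto simp: polys_upto_def)
qed

lemma keys_hasse_deriv:
  assumes "b \<in> Poly_Mapping.keys (hasse_deriv t i p)"
  obtains m where "m \<in> Poly_Mapping.keys p" "t \<le> Poly_Mapping.lookup m i"
    "b = m - Poly_Mapping.single i t"
proof -
  let ?g = "\<lambda>m. Poly_Mapping.single (m - Poly_Mapping.single i t)
         (of_nat (Poly_Mapping.lookup m i choose t) * Poly_Mapping.lookup p m)"
  have "(\<Sum>m\<in>Poly_Mapping.keys p. Poly_Mapping.lookup (?g m) b) \<noteq> 0"
    using assms by (simp add: in_keys_iff hasse_deriv_def lookup_sum)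
  then obtain m where m: "m \<in> Poly_Mapping.keys p" "Poly_Mapping.lookup (?g m) b \<noteq> 0"
    by (meson sum.neutral)
  have "t \<le> Poly_Mapping.lookup m i"
    using m(2) by (rule contrapos_np) (simp add: binomial_eq_0)
  moreover have "b = m - Poly_Mapping.single i t"
    using m(2) by (auto simp: lookup_single when_def split: if_splits)
  moreover note m(1)
  ultimately show ?thesis using that by blast
qed

lemma hasse_deriv_polys_upto:
  assumes "p \<in> polys_upto n d" "i < n"
  shows "hasse_deriv t i p \<in> polys_upto n (d - t)"
proof -
  have "mdeg n b \<le> d - t" if b: "b \<in> Poly_Mapping.keys (hasse_deriv t i p)" for b
  proof -
    obtain m where m: "m \<in> Poly_Mapping.keys p" "t \<le> Poly_Mapping.lookup m i"
        "b = m - Poly_Mapping.single i t"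
      using b by (rule keys_hasse_deriv)
    then show ?thesis
      using mdeg_minus_single[OF assms(2) m(2)] assms(1) by (force simp: polys_upto_def)
  qed
  then show ?thesis
    using assms hasse_deriv_polys by (auto simp: polys_upto_def)
qed

text \<open>
  If \<open>x\<^sub>i\<close> has exponent \<open>t\<close> in the monomial \<open>a\<close> of \<open>p\<close>, then \<open>D\<^sub>t\<^sub>,\<^sub>i\<close> maps \<open>a\<close> to \<open>a / x\<^sub>i^t\<close> with
  coefficient \<open>1\<close>, and no other monomial of \<open>p\<close> can contribute to \<open>a / x\<^sub>i^t\<close>.
\<close>

lemma hasse_deriv_top_nonzero:
  assumes a: "a \<in> Poly_Mapping.keys p"
  shows "hasse_deriv (Poly_Mapping.lookup a i) i p \<noteq> 0"
proof -
  let ?t = "Poly_Mapping.lookup a i"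
  let ?e = "Poly_Mapping.single i ?t"
  have "Poly_Mapping.lookup (hasse_deriv ?t i p) (a - ?e) =
    (\<Sum>m\<in>Poly_Mapping.keys p. if m = a then Poly_Mapping.lookup p a else 0)"
    unfolding hasse_deriv_def lookup_sum
  proof (intro sum.cong refl)
    fix m
    have "m = a" if "m - ?e = a - ?e" "?t \<le> Poly_Mapping.lookup m i"
      using that minus_single_add_single[of ?t m i] minus_single_add_single[of ?t a i] by simp
    then show "Poly_Mapping.lookup (Poly_Mapping.single (m - ?e)
        (of_nat (Poly_Mapping.lookup m i choose ?t) * Poly_Mapping.lookup p m)) (a - ?e) =
        (if m = a then Poly_Mapping.lookup p a else 0)"
      by (cases "?t \<le> Poly_Mapping.lookup m i")
         (auto simp: lookup_single when_def not_le binomial_eq_0)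
  qed
  also have "\<dots> = Poly_Mapping.lookup p a" using a by simp
  finally show ?thesis using a by (auto simp: in_keys_iff)
qed

section \<open>Filtrations compatible with differential operators\<close>

text \<open>
  Ascending chains of \<open>k\<close>-subspaces of the fraction field on which \<open>x\<^sub>i\<close> has degree \<open>1\<close> and
  \<open>D\<^sub>t\<^sub>,\<^sub>i\<close> has degree \<open>t\<close>.  Exhaustiveness and finite dimension are imposed where they are
  needed, so that constant families fall under the same definition.
\<close>

definition diff_filtration :: "nat \<Rightarrow> (nat \<Rightarrow> 'k::field mpol fract set) \<Rightarrow> bool" where
  "diff_filtration n M \<longleftrightarrow>
     (\<forall>s. 0 \<in> M s) \<and>
     (\<forall>s. \<forall>y\<in>M s. \<forall>z\<in>M s. y + z \<in> M s) \<and>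
     (\<forall>s c. \<forall>z\<in>M s. frac_of (Const c) * z \<in> M s) \<and>
     (\<forall>s. M s \<subseteq> M (Suc s)) \<and>
     (\<forall>s i. i < n \<longrightarrow> (\<forall>z\<in>M s. frac_of (Var i) * z \<in> M (Suc s))) \<and>
     (\<forall>s t i. i < n \<longrightarrow> (\<forall>z\<in>M s. hasse_fract t i z \<in> M (s + t)))"

context
  fixes n :: nat and M :: "nat \<Rightarrow> 'k::field mpol fract set"
  assumes filt: "diff_filtration n M"
begin

lemma filt_zero: "0 \<in> M s"
  and filt_add: "y \<in> M s \<Longrightarrow> z \<in> M s \<Longrightarrow> y + z \<in> M s"
  and filt_scale: "z \<in> M s \<Longrightarrow> frac_of (Const c) * z \<in> M s"
  and filt_Suc: "M s \<subseteq> M (Suc s)"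
  and filt_Var: "i < n \<Longrightarrow> z \<in> M s \<Longrightarrow> frac_of (Var i) * z \<in> M (Suc s)"
  and filt_hasse: "i < n \<Longrightarrow> z \<in> M s \<Longrightarrow> hasse_fract t i z \<in> M (s + t)"
  using filt unfolding diff_filtration_def by blast+

lemma filt_mono: "s \<le> s' \<Longrightarrow> M s \<subseteq> M s'"
  using filt_Suc by (rule lift_Suc_mono_le)

lemma filt_uminus: "z \<in> M s \<Longrightarrow> - z \<in> M s"
  using filt_scale[of z s "-1"] by (simp add: single_uminus frac_of_uminus frac_of_one
    del: mult_fract minus_fract)

lemma filt_diff: "y \<in> M s \<Longrightarrow> z \<in> M s \<Longrightarrow> y - z \<in> M s"
  using filt_add[of y s "- z"] filt_uminus[of z s] by simp

lemma filt_sum: "(\<And>x. x \<in> A \<Longrightarrow> g x \<in> M s) \<Longrightarrow> sum g A \<in> M s"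
  by (induction A rule: infinite_finite_induct) (auto simp: filt_zero filt_add)

lemma filt_monom:
  "Poly_Mapping.keys m \<subseteq> {..<n} \<Longrightarrow> z \<in> M s \<Longrightarrow>
    frac_of (Poly_Mapping.single m 1) * z \<in> M (s + mdeg n m)"
proof (induction "mdeg n m" arbitrary: m)
  case 0
  have "m = 0"
  proof (rule poly_mapping_eqI)
    fix i show "Poly_Mapping.lookup m i = Poly_Mapping.lookup 0 i"
      using 0 lookup_le_mdeg[of i n m] by (cases "i < n") (auto simp: in_keys_iff)
  qed
  then show ?case using 0 by (simp add: mdeg_zero frac_of_one)
next
  case (Suc d)
  then have "m \<noteq> 0" by (auto simp: mdeg_zero)
  then obtain i where i: "i \<in> Poly_Mapping.keys m" by (meson keys_eq_empty ex_in_conv)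
  then have i1: "1 \<le> Poly_Mapping.lookup m i" by (simp add: in_keys_iff Suc_le_eq)
  have i2: "i < n" using Suc.prems(1) i by auto
  let ?m = "m - Poly_Mapping.single i 1"
  have deg: "mdeg n m = mdeg n ?m + 1" by (rule mdeg_minus_single[OF i2 i1])
  have "Poly_Mapping.keys ?m \<subseteq> Poly_Mapping.keys m"
    by (auto simp: in_keys_iff lookup_minus)
  then have keys: "Poly_Mapping.keys ?m \<subseteq> {..<n}" using Suc.prems(1) by blast
  have IH: "frac_of (Poly_Mapping.single ?m 1) * z \<in> M (s + mdeg n ?m)"
    using Suc.hyps(1)[OF _ keys Suc.prems(2)] Suc.hyps(2) deg by simp
  have "(Poly_Mapping.single m 1 :: 'k mpol) = Var i * Poly_Mapping.single ?m 1"
    by (simp only: mult_single mult_1 add.commute[of "Poly_Mapping.single i 1"]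
      minus_single_add_single[OF i1])
  then have "frac_of (Poly_Mapping.single m 1) * z =
      frac_of (Var i) * (frac_of (Poly_Mapping.single ?m 1) * z)"
    by (simp only: frac_of_mult mult.assoc)
  moreover have "s + mdeg n m = Suc (s + mdeg n ?m)" using deg by simp
  ultimately show ?case using filt_Var[OF i2 IH] by (simp only:)
qed

end

text \<open>
  \<open>multi_hasse n t\<close> is the composition of the operators \<open>D\<close> with order \<open>t\<^sub>i\<close> in direction \<open>x\<^sub>i\<close>
  for all \<open>i < n\<close>, in a fixed order.  With the order fixed, commutators with variables can
  be computed without showing that these operators commute with each other.
\<close>

primrec multi_hasse :: "nat \<Rightarrow> (nat \<Rightarrow>\<^sub>0 nat) \<Rightarrow> 'k::field mpol fract \<Rightarrow> 'k mpol fract" where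
  "multi_hasse 0 t z = z"
| "multi_hasse (Suc l) t z = multi_hasse l t (hasse_fract (Poly_Mapping.lookup t l) l z)"

lemma filt_multi_hasse:
  assumes "diff_filtration n M"
  shows "l \<le> n \<Longrightarrow> z \<in> M s \<Longrightarrow> multi_hasse l t z \<in> M (s + mdeg l t)"
proof (induction l arbitrary: z s)
  case (Suc l)
  then have "hasse_fract (Poly_Mapping.lookup t l) l z \<in> M (s + Poly_Mapping.lookup t l)"
    using assms by (auto intro: filt_hasse)
  with Suc have "multi_hasse l t (hasse_fract (Poly_Mapping.lookup t l) l z)
      \<in> M (s + Poly_Mapping.lookup t l + mdeg l t)"
    by (intro Suc.IH) auto
  then show ?case by (simp add: mdeg_def ac_simps)
qed (simp add: mdeg_def)

lemma multi_hasse_add: "multi_hasse l t (y + z) = multi_hasse l t y + multi_hasse l t z"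
  by (induction l arbitrary: y z) (simp_all add: hasse_fract_add)

lemma multi_hasse_Const_mult:
  "multi_hasse l t (frac_of (Const c) * z) = frac_of (Const c) * multi_hasse l t z"
  by (induction l arbitrary: z) (simp_all add: hasse_fract_Const_mult del: mult_fract)

lemma multi_hasse_0: "multi_hasse l t 0 = 0"
  by (induction l) (simp_all add: hasse_fract_zero)

lemma multi_hasse_zero: "multi_hasse l 0 z = z"
  by (induction l arbitrary: z) (simp_all add: hasse_fract_0)

lemma multi_hasse_cong:
  "(\<And>i. i < l \<Longrightarrow> Poly_Mapping.lookup t i = Poly_Mapping.lookup t' i) \<Longrightarrow>
    multi_hasse l t z = multi_hasse l t' z"
  by (induction l arbitrary: z) simp_all

lemma multi_hasse_Var_mult:
  "multi_hasse l t (frac_of (Var i) * z) = frac_of (Var i) * multi_hasse l t z +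
     (if i < l \<and> 0 < Poly_Mapping.lookup t i
      then multi_hasse l (t - Poly_Mapping.single i 1) z else 0)"
proof (induction l arbitrary: z)
  case (Suc l)
  let ?t = "Poly_Mapping.lookup t l" and ?t' = "t - Poly_Mapping.single i 1"
  show ?case
  proof (cases "i = l")
    case True
    have "multi_hasse (Suc l) t (frac_of (Var i) * z) =
        multi_hasse l t (frac_of (Var i) * hasse_fract ?t l z +
          (if ?t > 0 then hasse_fract (?t - 1) l z else 0))"
      using True by (simp only: multi_hasse.simps hasse_fract_Var_mult) auto
    also have "\<dots> = frac_of (Var i) * multi_hasse (Suc l) t z +
        (if ?t > 0 then multi_hasse l t (hasse_fract (?t - 1) l z) else 0)"
      using True Suc.IH by (simp add: multi_hasse_add multi_hasse_0)
    also have "multi_hasse l t (hasse_fract (?t - 1) l z) = multi_hasse (Suc l) ?t' z"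
      using True by (auto simp: lookup_minus lookup_single intro!: multi_hasse_cong)
    finally show ?thesis using True by simp
  next
    case False
    have "multi_hasse (Suc l) t (frac_of (Var i) * z) =
        multi_hasse l t (frac_of (Var i) * hasse_fract ?t l z)"
      using False by (simp only: multi_hasse.simps hasse_fract_Var_mult) auto
    also have "\<dots> = frac_of (Var i) * multi_hasse (Suc l) t z +
        (if i < l \<and> 0 < Poly_Mapping.lookup t i then multi_hasse l ?t' (hasse_fract ?t l z) else 0)"
      by (simp only: Suc.IH multi_hasse.simps)
    also have "multi_hasse l ?t' (hasse_fract ?t l z) = multi_hasse (Suc l) ?t' z"
      using False by (simp add: lookup_minus lookup_single when_def)
    finally show ?thesis using False by simp
  qed
qed simp

text \<open>
  Stability under \<open>\<D>\<close> is compatibility of the constant family, which makes every fact about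
  filtrations available for submodules.
\<close>

definition diff_stable :: "nat \<Rightarrow> 'k::field mpol fract set \<Rightarrow> bool" where
  "diff_stable n N \<longleftrightarrow> diff_filtration n (\<lambda>_. N)"

lemma polys_in_polys_upto:
  assumes "p \<in> polys n"
  obtains d where "p \<in> polys_upto n d"
proof -
  have "p \<in> polys_upto n (Max (insert 0 (mdeg n ` Poly_Mapping.keys p)))"
    using assms by (auto simp: polys_upto_def intro: Max_ge)
  then show ?thesis using that by blast
qed

section \<open>Low order operators annihilate nothing\<close>

text \<open>
  If \<open>p\<close> maps \<open>M\<^sub>s\<close> into \<open>N\<close>, then \<open>D\<^sub>t\<^sub>,\<^sub>i(p)\<close> maps \<open>M\<^sub>s\<^sub>-\<^sub>t\<close> into \<open>N\<close>, by the Leibniz rule and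
  induction on \<open>t\<close>.  Choosing \<open>t\<close> as the exponent of \<open>x\<^sub>i\<close> in some monomial keeps the polynomial
  non-zero while its degree drops, until a non-zero constant remains.
\<close>

lemma no_annihilating_poly:
  assumes M: "diff_filtration n M" and N: "diff_stable n N"
  shows "p \<in> polys_upto n s \<Longrightarrow> p \<noteq> 0 \<Longrightarrow> (\<And>z. z \<in> M s \<Longrightarrow> frac_of p * z \<in> N) \<Longrightarrow> M 0 \<subseteq> N"
proof (induction s arbitrary: p rule: less_induct)
  case (less s)
  note N' = N[unfolded diff_stable_def]
  show ?case
  proof (cases "Poly_Mapping.keys p \<subseteq> {0}")
    case True
    define c where "c = Poly_Mapping.lookup p 0"
    have p: "p = Const c"
      using True by (intro poly_mapping_eqI)
        (auto simp: c_def lookup_single when_def in_keys_iff)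
    with less.prems have c: "c \<noteq> 0" by auto
    show ?thesis
    proof
      fix z assume "z \<in> M 0"
      then have "frac_of p * z \<in> N"
        using less.prems(3) filt_mono[OF M, of 0 s] by blast
      then have "frac_of (Const (inverse c)) * (frac_of p * z) \<in> N"
        by (rule filt_scale[OF N'])
      moreover have "Const (inverse c) * p = 1"
        using c by (simp add: p mult_single)
      ultimately show "z \<in> N"
        by (simp only: mult.assoc[symmetric] frac_of_mult[symmetric] frac_of_one mult_1)
    qed
  next
    case False
    then obtain a where a: "a \<in> Poly_Mapping.keys p" "a \<noteq> 0" by blast
    then obtain i where i: "i \<in> Poly_Mapping.keys a" by (meson keys_eq_empty ex_in_conv)
    define t where "t = Poly_Mapping.lookup a i"
    have i2: "i < n" and as: "mdeg n a \<le> s"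
      using less.prems(1) a i by (auto simp: polys_upto_def polys_def)
    have t0: "0 < t" using i by (simp add: t_def in_keys_iff)
    have ts: "t \<le> s" using lookup_le_mdeg[OF i2, of a] as by (simp add: t_def)
    \<comment> \<open>\<open>D\<^sub>r\<^sub>,\<^sub>i(p) z\<close> is the last term of the Leibniz rule for \<open>D\<^sub>r\<^sub>,\<^sub>i(p z)\<close>; the other terms
      are covered by the induction hypothesis, as \<open>D\<^sub>r\<^sub>-\<^sub>j\<^sub>,\<^sub>i z\<close> lies in \<open>M\<^sub>s\<^sub>-\<^sub>j\<close>.\<close>
    have kill: "frac_of (hasse_deriv r i p) * z \<in> N" if "r \<le> s" "z \<in> M (s - r)" for r z
      using that
    proof (induction r arbitrary: z rule: less_induct)
      case (less r)
      have "frac_of p * z \<in> N"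
        using less.prems \<open>\<And>z. z \<in> M s \<Longrightarrow> frac_of p * z \<in> N\<close> filt_mono[OF M, of "s - r" s] by auto
      then have D: "hasse_fract r i (frac_of p * z) \<in> N"
        using filt_hasse[OF N' i2] by blast
      have low: "frac_of (hasse_deriv j i p) * hasse_fract (r - j) i z \<in> N" if "j < r" for j
      proof (rule less.IH[OF that])
        have "hasse_fract (r - j) i z \<in> M (s - r + (r - j))"
          by (rule filt_hasse[OF M i2 less.prems(2)])
        then show "hasse_fract (r - j) i z \<in> M (s - j)"
          using that less.prems(1) by simp
      qed (use that less.prems in simp)
      have "hasse_fract r i (frac_of p * z) =
          (\<Sum>j\<le>r. frac_of (hasse_deriv j i p) * hasse_fract (r - j) i z)"
        by (simp only: hasse_fract_mult hasse_fract_frac_of)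
      also have "\<dots> = (\<Sum>j<r. frac_of (hasse_deriv j i p) * hasse_fract (r - j) i z) +
          frac_of (hasse_deriv r i p) * z"
        by (simp only: lessThan_Suc_atMost[symmetric] sum.lessThan_Suc diff_self_eq_0 hasse_fract_0)
      finally have "frac_of (hasse_deriv r i p) * z = hasse_fract r i (frac_of p * z) -
          (\<Sum>j<r. frac_of (hasse_deriv j i p) * hasse_fract (r - j) i z)"
        by (simp only: eq_diff_eq add.commute)
      moreover have "(\<Sum>j<r. frac_of (hasse_deriv j i p) * hasse_fract (r - j) i z) \<in> N"
        using low by (intro filt_sum[OF N']) auto
      ultimately show ?case using filt_diff[OF N' D] by simp
    qed
    show ?thesis
    proof (rule less.IH[of "s - t" "hasse_deriv t i p"])
      show "s - t < s" using t0 ts by simp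
      show "hasse_deriv t i p \<in> polys_upto n (s - t)"
        by (rule hasse_deriv_polys_upto[OF less.prems(1) i2])
      show "hasse_deriv t i p \<noteq> 0"
        unfolding t_def by (rule hasse_deriv_top_nonzero[OF a(1)])
    qed (use kill ts in blast)
  qed
qed

text \<open>
  For \<open>P = \<Sum>\<^sub>t p\<^sub>t D^t\<close> the commutator with \<open>x\<^sub>i\<close> is \<open>\<Sum>\<^sub>t p\<^sub>t D^(t - e\<^sub>i)\<close>, the sum running over the \<open>t\<close>
  in which \<open>i\<close> occurs: the coefficients stay the same and only the exponents shift.  If \<open>P\<close>
  maps \<open>M\<^sub>s\<close> into \<open>N\<close>, then this commutator maps \<open>M\<^sub>s\<^sub>-\<^sub>1\<close> into \<open>N\<close>.  After finitely many steps
  only a polynomial is left.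
\<close>

lemma no_annihilating_operator:
  assumes M: "diff_filtration n M" and N: "diff_stable n N"
  shows "finite T \<Longrightarrow>
    (\<And>t. t \<in> T \<Longrightarrow> Poly_Mapping.keys t \<subseteq> {..<n} \<and> mdeg n t \<le> s \<and> p t \<in> polys_upto n (s - mdeg n t)) \<Longrightarrow>
    \<exists>t\<in>T. p t \<noteq> 0 \<Longrightarrow>
    (\<And>z. z \<in> M s \<Longrightarrow> (\<Sum>t\<in>T. frac_of (p t) * multi_hasse n t z) \<in> N) \<Longrightarrow> M 0 \<subseteq> N"
proof (induction s arbitrary: T p rule: less_induct)
  case (less s)
  note N' = N[unfolded diff_stable_def]
  show ?case
  proof (cases "\<exists>t\<in>T. p t \<noteq> 0 \<and> t \<noteq> 0")
    case False
    then have p0: "0 \<in> T" "p 0 \<noteq> 0" using less.prems(3) by auto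
    have "(\<Sum>t\<in>T. frac_of (p t) * multi_hasse n t z) = frac_of (p 0) * z" for z
    proof -
      have "(\<Sum>t\<in>T. frac_of (p t) * multi_hasse n t z) =
          (\<Sum>t\<in>{0}. frac_of (p t) * multi_hasse n t z)"
        using False p0 less.prems(1)
        by (intro sum.mono_neutral_right) (auto simp: frac_of_zero)
      then show ?thesis by (simp add: multi_hasse_zero)
    qed
    then have "frac_of (p 0) * z \<in> N" if "z \<in> M s" for z
      using less.prems(4)[OF that] by simp
    moreover have "p 0 \<in> polys_upto n s"
      using less.prems(2)[OF p0(1)] by (simp add: mdeg_zero)
    ultimately show ?thesis
      using no_annihilating_poly[OF M N] p0(2) by blast
  next
    case True
    then obtain t0 where t0: "t0 \<in> T" "p t0 \<noteq> 0" "t0 \<noteq> 0" by blast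
    then obtain i where i: "i \<in> Poly_Mapping.keys t0" by (meson keys_eq_empty ex_in_conv)
    then have i1: "1 \<le> Poly_Mapping.lookup t0 i" by (simp add: in_keys_iff Suc_le_eq)
    have i2: "i < n" using less.prems(2)[OF t0(1)] i by auto
    have s: "0 < s"
      using less.prems(2)[OF t0(1)] lookup_le_mdeg[OF i2, of t0] i1 by linarith
    let ?e = "Poly_Mapping.single i (1::nat)"
    define T' where "T' = {t. t + ?e \<in> T}"
    define p' where "p' t = p (t + ?e)" for t
    show ?thesis
    proof (rule less.IH[of "s - 1" T' p'])
      show "s - 1 < s" using s by simp
      have "T' = (\<lambda>t. t + ?e) -` T" by (auto simp: T'_def)
      then show "finite T'"
        using less.prems(1) by (auto intro!: finite_vimageI injI)
      show "\<exists>t\<in>T'. p' t \<noteq> 0"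
      proof
        show "t0 - ?e \<in> T'" "p' (t0 - ?e) \<noteq> 0"
          using t0 minus_single_add_single[OF i1] by (simp_all add: T'_def p'_def)
      qed
    next
      fix t assume "t \<in> T'"
      then have t: "t + ?e \<in> T" by (simp add: T'_def)
      have "Poly_Mapping.keys t \<subseteq> Poly_Mapping.keys (t + ?e)"
        by (auto simp: in_keys_iff lookup_add)
      moreover have "mdeg n (t + ?e) = Suc (mdeg n t)"
        using mdeg_single[OF i2, of 1] by (simp add: mdeg_add)
      ultimately show "Poly_Mapping.keys t \<subseteq> {..<n} \<and> mdeg n t \<le> s - 1 \<and>
          p' t \<in> polys_upto n (s - 1 - mdeg n t)"
        using less.prems(2)[OF t] by (auto simp: p'_def)
    next
      fix z assume z: "z \<in> M (s - 1)"
      let ?P = "\<lambda>z. \<Sum>t\<in>T. frac_of (p t) * multi_hasse n t z"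
      have z1: "z \<in> M s" using z filt_mono[OF M, of "s - 1" s] by auto
      have z2: "frac_of (Var i) * z \<in> M s" using filt_Var[OF M i2 z] s by simp
      have "frac_of (Var i) * ?P z \<in> N"
        using filt_Var[OF N' i2 less.prems(4)[OF z1]] .
      with less.prems(4)[OF z2] have "?P (frac_of (Var i) * z) - frac_of (Var i) * ?P z \<in> N"
        by (rule filt_diff[OF N'])
      also have "?P (frac_of (Var i) * z) - frac_of (Var i) * ?P z =
          (\<Sum>t\<in>T. if 0 < Poly_Mapping.lookup t i
            then frac_of (p t) * multi_hasse n (t - ?e) z else 0)"
        unfolding sum_distrib_left sum_subtractf[symmetric] multi_hasse_Var_mult
        using i2 by (intro sum.cong) (simp_all add: distrib_left mult.left_commute del: mult_fract)
      also have "\<dots> = (\<Sum>t\<in>{t\<in>T. 0 < Poly_Mapping.lookup t i}.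
          frac_of (p t) * multi_hasse n (t - ?e) z)"
        using less.prems(1) by (simp only: sum.inter_filter)
      also have "\<dots> = (\<Sum>t\<in>T'. frac_of (p' t) * multi_hasse n t z)"
        by (rule sum.reindex_bij_witness[of _ "\<lambda>t. t + ?e" "\<lambda>t. t - ?e"])
           (auto simp: T'_def p'_def minus_single_add_single lookup_add Suc_le_eq)
      finally show "(\<Sum>t\<in>T'. frac_of (p' t) * multi_hasse n t z) \<in> N" .
    qed
  qed
qed

section \<open>Linear algebra modulo a subspace\<close>

text \<open>
  Gaussian elimination: solve the equation \<open>j\<close> for an unknown \<open>l\<close> that occurs in it, and
  substitute the solution into the other equations.
\<close>

lemma homogeneous_system_nontrivial:
  fixes A :: "'j \<Rightarrow> 'i \<Rightarrow> 'k::field"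
  assumes "finite J" "finite I" "card J < card I"
  shows "\<exists>c. (\<exists>i\<in>I. c i \<noteq> 0) \<and> (\<forall>j\<in>J. (\<Sum>i\<in>I. c i * A j i) = 0)"
  using assms
proof (induction J arbitrary: I A rule: finite_induct)
  case empty
  then have "I \<noteq> {}" by auto
  then show ?case by (intro exI[of _ "\<lambda>_. 1"]) auto
next
  case (insert j J)
  show ?case
  proof (cases "\<forall>i\<in>I. A j i = 0")
    case True
    have "card J < card I" using insert by simp
    then obtain c where "\<exists>i\<in>I. c i \<noteq> 0" "\<forall>j\<in>J. (\<Sum>i\<in>I. c i * A j i) = 0"
      using insert.IH insert.prems by blast
    then show ?thesis using True by (intro exI[of _ c]) auto
  next
    case False
    then obtain l where l: "l \<in> I" "A j l \<noteq> 0" by blast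
    let ?A = "\<lambda>j' i. A j' i - A j' l * (A j i / A j l)"
    have "card J < card (I - {l})" using insert l by (simp add: card_Diff_singleton)
    then obtain c where c: "\<exists>i\<in>I - {l}. c i \<noteq> 0"
        "\<forall>j'\<in>J. (\<Sum>i\<in>I - {l}. c i * ?A j' i) = 0"
      using insert.IH[of "I - {l}" ?A] insert.prems by auto
    define S where "S = (\<Sum>i\<in>I - {l}. c i * (A j i / A j l))"
    \<comment> \<open>The value at \<open>l\<close> is the one that solves the equation \<open>j\<close>.\<close>
    define d where "d = c(l := - S)"
    have split: "(\<Sum>i\<in>I. d i * A j' i) = - S * A j' l + (\<Sum>i\<in>I - {l}. c i * A j' i)" for j'
    proof -
      have "(\<Sum>i\<in>I. d i * A j' i) = d l * A j' l + (\<Sum>i\<in>I - {l}. d i * A j' i)"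
        using insert.prems l by (intro sum.remove) auto
      also have "(\<Sum>i\<in>I - {l}. d i * A j' i) = (\<Sum>i\<in>I - {l}. c i * A j' i)"
        by (intro sum.cong) (auto simp: d_def)
      finally show ?thesis by (simp add: d_def)
    qed
    have "(\<Sum>i\<in>I. d i * A j i) = 0"
    proof -
      have "S * A j l = (\<Sum>i\<in>I - {l}. c i * A j i)"
        unfolding S_def sum_distrib_right using l by (intro sum.cong) auto
      then show ?thesis by (simp add: split)
    qed
    moreover have "(\<Sum>i\<in>I. d i * A j' i) = 0" if "j' \<in> J" for j'
    proof -
      have "(\<Sum>i\<in>I - {l}. c i * ?A j' i) = (\<Sum>i\<in>I - {l}. c i * A j' i) - S * A j' l"
        unfolding S_def sum_distrib_right sum_subtractf[symmetric]
        by (intro sum.cong) (auto simp: algebra_simps)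
      then show ?thesis using c(2) that by (simp add: split)
    qed
    moreover have "\<exists>i\<in>I. d i \<noteq> 0" using c(1) by (auto simp: d_def)
    ultimately show ?thesis by (intro exI[of _ d]) auto
  qed
qed

context vector_space
begin

lemma independent_Un_trivial_Int:
  assumes "finite B" "independent A" "independent B" "span A \<inter> span B \<subseteq> {0}"
  shows "independent (A \<union> B)"
  using assms(1,3,4)
proof (induction B rule: finite_induct)
  case (insert b B)
  have sub: "span B \<subseteq> span (insert b B)" by (intro span_mono) auto
  have "independent B" using insert.prems(1) by (rule independent_mono) auto
  then have "independent (A \<union> B)"
    using sub insert.prems(2) by (intro insert.IH) auto
  moreover have "b \<notin> span (A \<union> B)"
  proof
    assume "b \<in> span (A \<union> B)"
    then obtain x y where xy: "b = x + y" "x \<in> span A" "y \<in> span B"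
      unfolding span_Un by blast
    have "y \<in> span (insert b B)" using xy(3) sub by blast
    then have "b - y \<in> span (insert b B)" by (intro span_diff[OF span_base]) auto
    then have "x = 0" using xy insert.prems(2) by auto
    then have "b \<in> span B" using xy by simp
    then show False using insert.prems(1) insert.hyps(2) by (simp add: independent_insert)
  qed
  ultimately show ?case by (simp add: independent_insertI)
qed (use assms(2) in simp)

lemma in_span_if_representation_vanishes:
  assumes ind: "independent (B \<union> E)" and x: "x \<in> span (B \<union> E)"
    and "\<And>e. e \<in> E \<Longrightarrow> representation (B \<union> E) x e = 0"
  shows "x \<in> span B"
proof -
  have "x = (\<Sum>b | representation (B \<union> E) x b \<noteq> 0. representation (B \<union> E) x b *s b)"
    using sum_nonzero_representation_eq[OF ind x] by simp
  also have "\<dots> \<in> span B"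
    using assms(3) representation_ne_zero
    by (intro span_sum span_scale span_base) blast
  finally show ?thesis .
qed

text \<open>
  The cardinality of \<open>E\<close> is the dimension of \<open>V / U\<close>; working with \<open>E\<close> avoids quotient spaces.
\<close>

lemma relative_basis:
  assumes "subspace U" "subspace V" "U \<subseteq> V" "V \<subseteq> span S" "finite S"
  obtains B E where "finite B" "finite E" "independent (B \<union> E)" "span B = U" "span (B \<union> E) = V"
    "B \<subseteq> U" "E \<subseteq> V" "span E \<inter> U = {0}"
proof -
  obtain B where B: "B \<subseteq> U" "independent B" "U \<subseteq> span B"
    by (rule maximal_independent_subset)
  obtain C where C: "B \<subseteq> C" "C \<subseteq> V" "independent C" "V \<subseteq> span C"
    by (rule maximal_independent_subset_extend[OF order_trans[OF B(1) assms(3)] B(2)])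
  have "finite C"
    using independent_span_bound[OF assms(5) C(3)] C(2) assms(4) by blast
  let ?E = "C - B"
  have BE: "B \<union> ?E = C" using C(1) by blast
  have sB: "span B = U" using B assms(1) by (intro span_subspace)
  have "x = 0" if x: "x \<in> span ?E" "x \<in> span B" for x
  proof -
    have xC: "x \<in> span C" using x(2) span_mono[OF C(1)] by blast
    have "representation C x = representation B x"
      by (rule representation_extend[OF C(3) x(2) C(1)])
    moreover have "representation C x = representation ?E x"
      by (rule representation_extend[OF C(3) x(1)]) auto
    ultimately have "representation C x b = 0" for b
      by (metis DiffD2 representation_ne_zero)
    then show "x = 0" using sum_nonzero_representation_eq[OF C(3) xC] by simp
  qed
  then have "span ?E \<inter> U = {0}" using sB span_zero[of ?E] subspace_0[OF assms(1)] by blast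
  moreover have "span (B \<union> ?E) = V"
    unfolding BE using C assms(2) by (intro span_subspace)
  moreover have "finite B" "finite ?E" "independent (B \<union> ?E)" "?E \<subseteq> V"
    unfolding BE using C \<open>finite C\<close> by (auto intro: finite_subset)
  ultimately show ?thesis using that[of B ?E] sB B(1) by simp
qed

text \<open>
  The operators \<open>T\<^sub>i\<close> induce linear maps from \<open>V / U\<close> to \<open>V' / U'\<close>, where \<open>U\<close>, \<open>V\<close>, \<open>U'\<close>, \<open>V'\<close> are
  the spans of \<open>B\<close>, \<open>B \<union> E\<close>, \<open>B'\<close>, \<open>B' \<union> E'\<close>.  These maps form a space of dimension
  \<open>card E * card E'\<close>, so more than that many of them are linearly dependent.
\<close>

lemma exists_combination_into_subspace:
  assumes BE: "finite E" "independent (B \<union> E)"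
    and BE': "finite E'" "independent (B' \<union> E')"
    and I: "finite I" "card E * card E' < card I"
    and add: "\<And>i x y. i \<in> I \<Longrightarrow> T i (x + y) = T i x + T i y"
    and scale: "\<And>i c x. i \<in> I \<Longrightarrow> T i (c *s x) = c *s T i x"
    and U: "\<And>i x. i \<in> I \<Longrightarrow> x \<in> span B \<Longrightarrow> T i x \<in> span B'"
    and V: "\<And>i x. i \<in> I \<Longrightarrow> x \<in> span (B \<union> E) \<Longrightarrow> T i x \<in> span (B' \<union> E')"
  shows "\<exists>c. (\<exists>i\<in>I. c i \<noteq> 0) \<and> (\<forall>x \<in> span (B \<union> E). (\<Sum>i\<in>I. c i *s T i x) \<in> span B')"
proof -
  let ?r = "representation (B' \<union> E')"
  define A where "A = (\<lambda>(e, e') i. ?r (T i e) e')"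
  have "card (E \<times> E') < card I" using I(2) by (simp add: card_cartesian_product)
  then obtain c where c: "\<exists>i\<in>I. c i \<noteq> 0" "\<forall>j\<in>E \<times> E'. (\<Sum>i\<in>I. c i * A j i) = 0"
    using homogeneous_system_nontrivial[of "E \<times> E'" I A] BE(1) BE'(1) I(1) by blast
  let ?P = "\<lambda>x. \<Sum>i\<in>I. c i *s T i x"
  have PE: "?P e \<in> span B'" if e: "e \<in> E" for e
  proof (rule in_span_if_representation_vanishes[OF BE'(2)])
    have T: "T i e \<in> span (B' \<union> E')" if "i \<in> I" for i
      using that e by (intro V) (auto intro: span_base)
    then show "?P e \<in> span (B' \<union> E')" by (intro span_sum span_scale)
    fix e' assume e': "e' \<in> E'"
    have "?r (?P e) = (\<lambda>b. \<Sum>i\<in>I. ?r (c i *s T i e) b)"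
      using T by (intro representation_sum[OF BE'(2)] span_scale) auto
    then have "?r (?P e) e' = (\<Sum>i\<in>I. c i * ?r (T i e) e')"
      using T by (auto simp: representation_scale[OF BE'(2)] intro!: sum.cong)
    also have "\<dots> = 0" using c(2) e e' by (auto simp: A_def)
    finally show "?r (?P e) e' = 0" .
  qed
  have T0: "T i 0 = 0" if "i \<in> I" for i
    using scale[OF that, of 0 0] by simp
  have "subspace {x. ?P x \<in> span B'}"
    unfolding subspace_def
  proof (intro conjI allI ballI; simp)
    show "?P 0 \<in> span B'" by (simp add: T0 span_zero)
  next
    fix x y assume xy: "?P x \<in> span B'" "?P y \<in> span B'"
    have "?P (x + y) = ?P x + ?P y"
      unfolding sum.distrib[symmetric] by (intro sum.cong) (auto simp: add scale_right_distrib)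
    then show "?P (x + y) \<in> span B'" using xy by (simp add: span_add)
  next
    fix d x assume x: "?P x \<in> span B'"
    have "?P (d *s x) = d *s ?P x"
      unfolding scale_sum_right by (intro sum.cong) (auto simp: scale scale_left_commute)
    then show "?P (d *s x) \<in> span B'" using x by (simp add: span_scale)
  qed
  moreover have "B \<union> E \<subseteq> {x. ?P x \<in> span B'}"
  proof
    fix x assume "x \<in> B \<union> E"
    then show "x \<in> {x. ?P x \<in> span B'}"
    proof
      assume "x \<in> B"
      then have "?P x \<in> span B'" by (intro span_sum span_scale U span_base)
      then show ?thesis by simp
    qed (use PE in simp)
  qed
  ultimately have "span (B \<union> E) \<subseteq> {x. ?P x \<in> span B'}" by (intro span_minimal)
  then show ?thesis using c(1) by blast
qed

end

text \<open>The fraction field as a vector space over the field of constants.\<close>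

interpretation kspace: vector_space "\<lambda>c z. frac_of (Const c) * z"
proof
  fix a b :: 'a and x y :: "'a mpol fract"
  show "frac_of (Const a) * (x + y) = frac_of (Const a) * x + frac_of (Const a) * y"
    by (rule distrib_left)
  show "frac_of (Const (a + b)) * x = frac_of (Const a) * x + frac_of (Const b) * x"
    by (simp only: single_add frac_of_add distrib_right)
  show "frac_of (Const a) * (frac_of (Const b) * x) = frac_of (Const (a * b)) * x"
    by (simp only: mult.assoc[symmetric] frac_of_mult[symmetric] mult_single add_0)
  show "frac_of (Const 1) * x = x"
    by (simp only: single_one frac_of_one mult_1)
qed

lemma filtration_subspace: "diff_filtration n M \<Longrightarrow> kspace.subspace (M s)"
  unfolding kspace.subspace_def using filt_zero filt_add filt_scale by blast

lemma stable_subspace: "diff_stable n N \<Longrightarrow> kspace.subspace N"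
  unfolding diff_stable_def by (rule filtration_subspace)

section \<open>Growth of subquotients and length of chains\<close>

text \<open>
  Monomials in a box are easy to count, and comparing boxes with balls costs only constant
  factors, which do not matter for the order of growth.
\<close>

definition box :: "nat \<Rightarrow> nat \<Rightarrow> (nat \<Rightarrow>\<^sub>0 nat) set" where
  "box n q = {m. Poly_Mapping.keys m \<subseteq> {..<n} \<and> (\<forall>i. Poly_Mapping.lookup m i \<le> q)}"

lemma box_bij: "bij_betw (\<lambda>m. restrict (Poly_Mapping.lookup m) {..<n}) (box n q) (PiE {..<n} (\<lambda>_. {..q}))"
proof (rule bij_betw_byWitness)
  let ?h = "\<lambda>g. Abs_poly_mapping (\<lambda>i. if i < n then g i else 0 :: nat)"
  have fin: "finite {i. (if i < n then g i else 0 :: nat) \<noteq> 0}" for g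
    by (rule finite_subset[of _ "{..<n}"]) auto
  have look: "Poly_Mapping.lookup (?h g) = (\<lambda>i. if i < n then g i else 0)" for g
    by (rule lookup_Abs_poly_mapping[OF fin])
  show "\<forall>m\<in>box n q. ?h (restrict (Poly_Mapping.lookup m) {..<n}) = m"
  proof
    fix m assume "m \<in> box n q"
    then show "?h (restrict (Poly_Mapping.lookup m) {..<n}) = m"
      by (intro poly_mapping_eqI) (auto simp: look box_def in_keys_iff)
  qed
  show "\<forall>g\<in>PiE {..<n} (\<lambda>_. {..q}). restrict (Poly_Mapping.lookup (?h g)) {..<n} = g"
    by (auto simp: look fun_eq_iff PiE_def extensional_def restrict_def)
  show "(\<lambda>m. restrict (Poly_Mapping.lookup m) {..<n}) ` box n q \<subseteq> PiE {..<n} (\<lambda>_. {..q})"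
    by (simp add: box_def restrict_PiE_iff image_subset_iff)
  show "?h ` PiE {..<n} (\<lambda>_. {..q}) \<subseteq> box n q"
    by (auto simp: box_def look in_keys_iff PiE_def split: if_splits)
qed

lemma card_box: "card (box n q) = (q + 1) ^ n"
  using bij_betw_same_card[OF box_bij, of n q] by (simp add: card_PiE)

lemma finite_box: "finite (box n q)"
  using bij_betw_finite[OF box_bij, of n q] by (simp add: finite_PiE)

lemma mdeg_box: "m \<in> box n q \<Longrightarrow> mdeg n m \<le> n * q"
  unfolding mdeg_def box_def
  using sum_bounded_above[of "{..<n}" "Poly_Mapping.lookup m" q] by simp

lemma mdeg_le_box: "Poly_Mapping.keys m \<subseteq> {..<n} \<Longrightarrow> mdeg n m \<le> q \<Longrightarrow> m \<in> box n q"
  unfolding box_def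
proof (intro CollectI conjI allI)
  fix i
  assume a: "Poly_Mapping.keys m \<subseteq> {..<n}" "mdeg n m \<le> q"
  show "Poly_Mapping.lookup m i \<le> q"
  proof (cases "i < n")
    case True
    then show ?thesis using lookup_le_mdeg[OF True, of m] a(2) by simp
  next
    case False
    then have "i \<notin> Poly_Mapping.keys m" using a(1) by auto
    then show ?thesis by (simp add: in_keys_iff)
  qed
qed

text \<open>
  If both \<open>L\<^sub>s\<close> and \<open>L\<^sub>2\<^sub>s\<close> had dimension below \<open>(q + 1)^n\<close> modulo \<open>N\<close>, then some non-zero combination
  of the \<open>(q + 1)^(2 n)\<close> operators \<open>x^a D^t\<close> with exponents at most \<open>q\<close> would map \<open>L\<^sub>s\<close> into \<open>N\<close>,
  and \<open>no_annihilating_operator\<close> would give \<open>u \<in> N\<close>.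
\<close>

lemma relative_growth:
  assumes M: "diff_filtration n M" and fd: "\<And>s. \<exists>S. finite S \<and> M s \<subseteq> kspace.span S"
    and N: "diff_stable n N" and N': "diff_stable n N'" and sub: "N \<subseteq> N'"
    and u: "u \<in> N'" "u \<notin> N" "u \<in> M r"
  shows "\<exists>E. finite E \<and> E \<subseteq> N' \<inter> M (r + 4 * n * q) \<and> kspace.independent E \<and>
    kspace.span E \<inter> N = {0} \<and> (q + 1) ^ n \<le> card E"
proof -
  \<comment> \<open>Each of the two exponents of an operator has degree at most \<open>n q\<close>.\<close>
  define s where "s = 2 * n * q"
  define L where "L j = N' \<inter> M (r + j)" for j
  have L: "diff_filtration n L"
  proof -
    note N1' = N'[unfolded diff_stable_def]
    have "hasse_fract t i z \<in> M (r + (j + t))" if "i < n" "z \<in> M (r + j)" for j t i z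
      using filt_hasse[OF M that, of t] by (simp only: add.assoc)
    then show ?thesis
      unfolding diff_filtration_def L_def
      using filt_Var[OF M] filt_Suc[OF M] filt_Var[OF N1'] filt_hasse[OF N1']
      by (auto simp: filt_zero[OF M] filt_zero[OF N1'] filt_add[OF M] filt_add[OF N1']
        filt_scale[OF M] filt_scale[OF N1'] intro: subsetD[OF filt_Suc[OF M]]
        simp del: One_nat_def mult_fract)
  qed
  note N1 = N[unfolded diff_stable_def]
  have fdL: "\<exists>S. finite S \<and> L j \<subseteq> kspace.span S" for j
    using fd[of "r + j"] unfolding L_def by blast
  have sub_s: "kspace.subspace (N \<inter> L j)" "kspace.subspace (L j)" for j
    by (intro kspace.subspace_inter stable_subspace[OF N] filtration_subspace[OF L])+
  obtain S where S: "finite S" "L s \<subseteq> kspace.span S" using fdL by blast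
  obtain S' where S': "finite S'" "L (2 * s) \<subseteq> kspace.span S'" using fdL by blast
  obtain B E where BE: "finite B" "finite E" "kspace.independent (B \<union> E)"
      "kspace.span B = N \<inter> L s" "kspace.span (B \<union> E) = L s" "B \<subseteq> N \<inter> L s" "E \<subseteq> L s"
      "kspace.span E \<inter> (N \<inter> L s) = {0}"
    using kspace.relative_basis[OF sub_s(1) sub_s(2) Int_lower2 S(2,1)] by blast
  obtain B' E' where BE': "finite B'" "finite E'" "kspace.independent (B' \<union> E')"
      "kspace.span B' = N \<inter> L (2 * s)" "kspace.span (B' \<union> E') = L (2 * s)" "B' \<subseteq> N \<inter> L (2 * s)"
      "E' \<subseteq> L (2 * s)" "kspace.span E' \<inter> (N \<inter> L (2 * s)) = {0}"
    using kspace.relative_basis[OF sub_s(1) sub_s(2) Int_lower2 S'(2,1)] by blast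
  have spans: "kspace.span E \<inter> N = {0}" "kspace.span E' \<inter> N = {0}"
  proof -
    have "kspace.span E \<subseteq> L s" using BE(7) sub_s(2) by (rule kspace.span_minimal)
    then show "kspace.span E \<inter> N = {0}" using BE(8) by blast
    have "kspace.span E' \<subseteq> L (2 * s)" using BE'(7) sub_s(2) by (rule kspace.span_minimal)
    then show "kspace.span E' \<inter> N = {0}" using BE'(8) by blast
  qed
  have Ls: "L s \<subseteq> L (2 * s)" by (rule filt_mono[OF L]) simp
  have L2s: "L (2 * s) = N' \<inter> M (r + 4 * n * q)" by (simp add: L_def s_def mult.assoc)
  have indep: "kspace.independent E" "kspace.independent E'"
    by (rule kspace.independent_mono[OF BE(3)] kspace.independent_mono[OF BE'(3)], simp)+
  have "(q + 1) ^ n \<le> card E \<or> (q + 1) ^ n \<le> card E'"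
  proof (rule ccontr)
    assume "\<not> ?thesis"
    then have "card E * card E' < (q + 1) ^ n * (q + 1) ^ n"
      by (intro mult_strict_mono) auto
    then have lt: "card E * card E' < card (box n q \<times> box n q)"
      by (simp add: card_box card_cartesian_product)
    define T :: "(nat \<Rightarrow>\<^sub>0 nat) \<times> (nat \<Rightarrow>\<^sub>0 nat) \<Rightarrow> 'a mpol fract \<Rightarrow> 'a mpol fract" where
      "T = (\<lambda>(t, a) z. frac_of (Poly_Mapping.single a 1) * multi_hasse n t z)"
    have TL: "T i z \<in> L (2 * s)" if i: "i \<in> box n q \<times> box n q" and z: "z \<in> L s" for i z
    proof -
      obtain t a where ta: "i = (t, a)" "t \<in> box n q" "a \<in> box n q" using i by auto
      have "multi_hasse n t z \<in> L (s + mdeg n t)"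
        by (rule filt_multi_hasse[OF L _ z]) simp
      then have "T i z \<in> L (s + mdeg n t + mdeg n a)"
        using ta by (simp add: T_def filt_monom[OF L] box_def)
      moreover have "s + mdeg n t + mdeg n a \<le> 2 * s"
        using mdeg_box[OF ta(2)] mdeg_box[OF ta(3)] by (simp add: s_def)
      ultimately show ?thesis using filt_mono[OF L] by blast
    qed
    have TN: "T i z \<in> N" if i: "i \<in> box n q \<times> box n q" and z: "z \<in> N" for i z
    proof -
      obtain t a where ta: "i = (t, a)" "a \<in> box n q" using i by auto
      have "multi_hasse n t z \<in> N"
        using filt_multi_hasse[OF N1 order_refl z] .
      then show ?thesis
        using ta by (simp add: T_def filt_monom[OF N1] box_def)
    qed
    have "\<exists>c. (\<exists>i\<in>box n q \<times> box n q. c i \<noteq> 0) \<and> (\<forall>x \<in> kspace.span (B \<union> E).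
        (\<Sum>i\<in>box n q \<times> box n q. frac_of (Const (c i)) * T i x) \<in> kspace.span B')"
    proof (rule kspace.exists_combination_into_subspace[OF BE(2,3) BE'(2,3) _ lt])
      show "finite (box n q \<times> box n q)" by (simp add: finite_box)
    next
      fix i x assume "i \<in> box n q \<times> box n q" "x \<in> kspace.span B"
      then show "T i x \<in> kspace.span B'" using TL TN by (simp add: BE(4) BE'(4))
    next
      fix i x assume "i \<in> box n q \<times> box n q" "x \<in> kspace.span (B \<union> E)"
      then show "T i x \<in> kspace.span (B' \<union> E')" using TL by (simp add: BE(5) BE'(5))
    next
      fix i :: "(nat \<Rightarrow>\<^sub>0 nat) \<times> (nat \<Rightarrow>\<^sub>0 nat)" and x y :: "'a mpol fract" and c :: 'a
      show "T i (x + y) = T i x + T i y"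
        by (cases i) (simp add: T_def multi_hasse_add distrib_left)
      show "T i (frac_of (Const c) * x) = frac_of (Const c) * T i x"
        by (cases i) (simp only: T_def multi_hasse_Const_mult mult.left_commute prod.case)
    qed
    then obtain c where c: "\<exists>i\<in>box n q \<times> box n q. c i \<noteq> 0"
        "\<And>x. x \<in> L s \<Longrightarrow> (\<Sum>i\<in>box n q \<times> box n q. frac_of (Const (c i)) * T i x) \<in> N"
      unfolding BE(4,5) BE'(4) by blast
    define p where "p t = (\<Sum>a\<in>box n q. Poly_Mapping.single a (c (t, a)))" for t
    have look: "Poly_Mapping.lookup (p t) a = (if a \<in> box n q then c (t, a) else 0)" for t a
      unfolding p_def lookup_sum lookup_single when_def by (simp add: finite_box)
    have "L 0 \<subseteq> N"
    proof (rule no_annihilating_operator[OF L N finite_box])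
      fix t assume t: "t \<in> box n q"
      have "Poly_Mapping.keys (p t) \<subseteq> box n q"
        by (auto simp: in_keys_iff[of _ "p t"] look split: if_splits)
      moreover have "Poly_Mapping.keys m \<subseteq> {..<n}" "mdeg n m \<le> n * q" if "m \<in> box n q" for m
        using that mdeg_box by (auto simp only: box_def)
      ultimately have "p t \<in> polys_upto n (n * q)"
        unfolding polys_upto_def polys_def by blast
      moreover have "n * q \<le> s - mdeg n t" using mdeg_box[OF t] by (simp add: s_def)
      ultimately have "p t \<in> polys_upto n (s - mdeg n t)" by (rule polys_upto_mono)
      then show "Poly_Mapping.keys t \<subseteq> {..<n} \<and> mdeg n t \<le> s \<and> p t \<in> polys_upto n (s - mdeg n t)"
        using t mdeg_box[OF t] by (simp add: box_def s_def)
    next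
      from c(1) obtain t a where ta: "t \<in> box n q" "a \<in> box n q" "c (t, a) \<noteq> 0" by auto
      then have "Poly_Mapping.lookup (p t) a \<noteq> 0" by (simp add: look)
      then have "p t \<noteq> 0" by auto
      then show "\<exists>t\<in>box n q. p t \<noteq> 0" using ta(1) by blast
    next
      fix z assume "z \<in> L s"
      then have "(\<Sum>i\<in>box n q \<times> box n q. frac_of (Const (c i)) * T i z) \<in> N" by (rule c(2))
      also have "(\<Sum>i\<in>box n q \<times> box n q. frac_of (Const (c i)) * T i z) =
          (\<Sum>t\<in>box n q. \<Sum>a\<in>box n q. frac_of (Const (c (t, a))) *
            (frac_of (Poly_Mapping.single a 1) * multi_hasse n t z))"
        by (simp only: T_def sum.cartesian_product split_def prod.collapse)
      also have "\<dots> = (\<Sum>t\<in>box n q. frac_of (p t) * multi_hasse n t z)"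
      proof (intro sum.cong refl)
        fix t
        have "frac_of (Const (c (t, a))) * (frac_of (Poly_Mapping.single a 1) * multi_hasse n t z) =
            frac_of (Poly_Mapping.single a (c (t, a))) * multi_hasse n t z" for a
          by (simp only: mult.assoc[symmetric] frac_of_mult[symmetric] mult_single add_0 mult_1_right)
        then show "(\<Sum>a\<in>box n q. frac_of (Const (c (t, a))) *
            (frac_of (Poly_Mapping.single a 1) * multi_hasse n t z)) = frac_of (p t) * multi_hasse n t z"
          by (simp only: p_def frac_of_sum sum_distrib_right)
      qed
      finally show "(\<Sum>t\<in>box n q. frac_of (p t) * multi_hasse n t z) \<in> N" .
    qed
    then show False using u by (auto simp: L_def)
  qed
  then show ?thesis
  proof
    assume "(q + 1) ^ n \<le> card E"
    moreover have "E \<subseteq> N' \<inter> M (r + 4 * n * q)" using BE(7) Ls L2s by blast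
    ultimately show ?thesis using BE(2) indep(1) spans(1) by blast
  next
    assume "(q + 1) ^ n \<le> card E'"
    moreover have "E' \<subseteq> N' \<inter> M (r + 4 * n * q)" using BE'(7) L2s by blast
    ultimately show ?thesis using BE'(2) indep(2) spans(2) by blast
  qed
qed

text \<open>
  The sets \<open>E\<close> of \<open>relative_growth\<close> for the consecutive steps of the chain are jointly linearly
  independent.  One \<open>r\<close> serves all steps, so they lie in the same member of the filtration.
\<close>

lemma chain_growth:
  assumes M: "diff_filtration n M" and fd: "\<And>s. \<exists>S. finite S \<and> M s \<subseteq> kspace.span S"
    and exh: "N l \<subseteq> (\<Union>s. M s)"
    and N: "\<And>i. i \<le> l \<Longrightarrow> diff_stable n (N i)" and lt: "\<And>i. i < l \<Longrightarrow> N i \<subset> N (Suc i)"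
  shows "\<exists>r. \<forall>q. \<exists>B. finite B \<and> B \<subseteq> M (r + 4 * n * q) \<and> kspace.independent B \<and>
    l * (q + 1) ^ n \<le> card B"
proof -
  have mono: "N i \<subseteq> N j" if "i \<le> j" "j \<le> l" for i j
    using that
  proof (induction j rule: dec_induct)
    case (step k)
    then show ?case using lt[of k] by auto
  qed simp
  \<comment> \<open>A common level of the filtration that sees all steps of the chain.\<close>
  have "\<exists>r. \<forall>i<j. \<exists>u. u \<in> N (Suc i) \<and> u \<notin> N i \<and> u \<in> M r" if "j \<le> l" for j
    using that
  proof (induction j)
    case (Suc j)
    then obtain r where r: "\<forall>i<j. \<exists>u. u \<in> N (Suc i) \<and> u \<notin> N i \<and> u \<in> M r" by auto
    obtain u where u: "u \<in> N (Suc j)" "u \<notin> N j" using lt[of j] Suc.prems by auto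
    moreover obtain r' where "u \<in> M r'" using u(1) exh mono[of "Suc j" l] Suc.prems by blast
    ultimately have "\<exists>u. u \<in> N (Suc j) \<and> u \<notin> N j \<and> u \<in> M (max r r')"
      using filt_mono[OF M, of r' "max r r'"] by auto
    moreover have "\<exists>u. u \<in> N (Suc i) \<and> u \<notin> N i \<and> u \<in> M (max r r')" if "i < j" for i
      using r that filt_mono[OF M, of r "max r r'"] by fastforce
    ultimately show ?case by (metis less_Suc_eq)
  qed auto
  then obtain r where r: "\<And>i. i < l \<Longrightarrow> \<exists>u. u \<in> N (Suc i) \<and> u \<notin> N i \<and> u \<in> M r"
    by blast
  have "\<exists>B. finite B \<and> B \<subseteq> N j \<inter> M (r + 4 * n * q) \<and> kspace.independent B \<and> j * (q + 1) ^ n \<le> card B"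
    if "j \<le> l" for j q
    using that
  proof (induction j)
    case 0
    then show ?case by (intro exI[of _ "{}"]) (simp add: kspace.independent_empty)
  next
    case (Suc j)
    then obtain B where B: "finite B" "B \<subseteq> N j \<inter> M (r + 4 * n * q)" "kspace.independent B"
        "j * (q + 1) ^ n \<le> card B" by auto
    obtain u where u: "u \<in> N (Suc j)" "u \<notin> N j" "u \<in> M r" using r[of j] Suc.prems by auto
    obtain E where E: "finite E" "E \<subseteq> N (Suc j) \<inter> M (r + 4 * n * q)" "kspace.independent E"
        "kspace.span E \<inter> N j = {0}" "(q + 1) ^ n \<le> card E"
      using relative_growth[OF M fd N N mono u, of q] Suc.prems by auto
    have "kspace.span B \<subseteq> N j"
      using B(2) stable_subspace[OF N] Suc.prems by (intro kspace.span_minimal) auto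
    then have "kspace.independent (B \<union> E)"
      using E(4) by (intro kspace.independent_Un_trivial_Int[OF E(1) B(3) E(3)]) auto
    moreover have "B \<inter> E = {}"
    proof -
      have "b = 0" if "b \<in> B" "b \<in> E" for b
        using that E(4) B(2) kspace.span_base[of b E] by blast
      then show ?thesis using kspace.dependent_zero[of B] B(3) by blast
    qed
    then have "Suc j * (q + 1) ^ n \<le> card (B \<union> E)"
      using B(1,4) E(1,5) by (simp add: card_Un_disjoint)
    moreover have "B \<union> E \<subseteq> N (Suc j) \<inter> M (r + 4 * n * q)"
      using B(2) E(2) mono[of j "Suc j"] Suc.prems by auto
    ultimately show ?case using B(1) E(1) by blast
  qed
  note levels = this
  show ?thesis
  proof (intro exI[of _ r] allI)
    fix q
    show "\<exists>B. finite B \<and> B \<subseteq> M (r + 4 * n * q) \<and> kspace.independent B \<and> l * (q + 1) ^ n \<le> card B"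
      using levels[OF order_refl, of q] by auto
  qed
qed

text \<open>
  Both bounds are of order \<open>q^n\<close>; taking for \<open>q\<close> the shift \<open>r\<close> of \<open>chain_growth\<close> itself turns
  them into a bound for \<open>l\<close> in which \<open>q\<close> cancels.
\<close>

lemma chain_length_bound:
  assumes M: "diff_filtration n M"
    and dim: "\<And>s. \<exists>S. finite S \<and> M s \<subseteq> kspace.span S \<and> card S \<le> (s * d + 1) ^ n"
    and exh: "N l \<subseteq> (\<Union>s. M s)"
    and N: "\<And>i. i \<le> l \<Longrightarrow> diff_stable n (N i)" and lt: "\<And>i. i < l \<Longrightarrow> N i \<subset> N (Suc i)"
  shows "l \<le> ((4 * n + 1) * d + 1) ^ n"
proof -
  have fd: "\<exists>S. finite S \<and> M s \<subseteq> kspace.span S" for s using dim by blast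
  obtain q where q: "\<And>r. \<exists>B. finite B \<and> B \<subseteq> M (q + 4 * n * r) \<and> kspace.independent B \<and>
    l * (r + 1) ^ n \<le> card B"
    using chain_growth[OF M fd exh N lt] by blast
  obtain B where B: "finite B" "B \<subseteq> M (q + 4 * n * q)" "kspace.independent B"
      "l * (q + 1) ^ n \<le> card B" using q by blast
  obtain S where S: "finite S" "M (q + 4 * n * q) \<subseteq> kspace.span S"
      "card S \<le> ((q + 4 * n * q) * d + 1) ^ n" using dim by blast
  have "card B \<le> card S"
    using kspace.independent_span_bound[OF S(1) B(3)] B(2) S(2) by blast
  then have "l * (q + 1) ^ n \<le> ((q + 4 * n * q) * d + 1) ^ n"
    using B(4) S(3) by linarith
  also have "\<dots> \<le> (((4 * n + 1) * d + 1) * (q + 1)) ^ n"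
    by (intro power_mono) (simp_all add: algebra_simps)
  finally have "l * (q + 1) ^ n \<le> ((4 * n + 1) * d + 1) ^ n * (q + 1) ^ n"
    by (simp only: power_mult_distrib)
  then show ?thesis by simp
qed

section \<open>The filtration of the localization by pole order\<close>

definition bounded_pole :: "nat \<Rightarrow> 'k::field mpol \<Rightarrow> nat \<Rightarrow> nat \<Rightarrow> 'k mpol fract set" where
  "bounded_pole n f e d = {Fraction_Field.Fract p (f ^ e) | p. p \<in> polys_upto n d}"

context
  fixes n :: nat and f :: "'k::field mpol" and b :: nat
  assumes f: "f \<in> polys_upto n b" and f0: "f \<noteq> 0"
begin

lemma bounded_poleI: "p \<in> polys_upto n d \<Longrightarrow> Fraction_Field.Fract p (f ^ e) \<in> bounded_pole n f e d"
  by (auto simp: bounded_pole_def)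

lemma bounded_pole_frac_of: "p \<in> polys_upto n d \<Longrightarrow> frac_of p \<in> bounded_pole n f 0 d"
  using bounded_poleI[of p d 0] by simp

lemma bounded_pole_mono: "z \<in> bounded_pole n f e d \<Longrightarrow> d \<le> d' \<Longrightarrow> z \<in> bounded_pole n f e d'"
  using polys_upto_mono by (fastforce simp: bounded_pole_def)

lemma bounded_pole_mult:
  assumes "y \<in> bounded_pole n f e d" "z \<in> bounded_pole n f e' d'"
  shows "y * z \<in> bounded_pole n f (e + e') (d + d')"
proof -
  obtain p q where "y = Fraction_Field.Fract p (f ^ e)" "p \<in> polys_upto n d"
      "z = Fraction_Field.Fract q (f ^ e')" "q \<in> polys_upto n d'"
    using assms by (auto simp: bounded_pole_def)
  then have "y * z = Fraction_Field.Fract (p * q) (f ^ (e + e'))" "p * q \<in> polys_upto n (d + d')"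
    by (simp_all add: power_add polys_upto_mult)
  then show ?thesis by (simp add: bounded_poleI)
qed

lemma bounded_pole_add:
  assumes "y \<in> bounded_pole n f e d" "z \<in> bounded_pole n f e d"
  shows "y + z \<in> bounded_pole n f e d"
proof -
  obtain p q where pq: "y = Fraction_Field.Fract p (f ^ e)" "p \<in> polys_upto n d"
      "z = Fraction_Field.Fract q (f ^ e)" "q \<in> polys_upto n d"
    using assms by (auto simp: bounded_pole_def)
  then have "y + z = Fraction_Field.Fract (p + q) (f ^ e)"
    using f0 by (simp add: eq_fract algebra_simps)
  then show ?thesis using pq by (simp add: bounded_poleI polys_upto_add)
qed

lemma zero_bounded_pole: "0 \<in> bounded_pole n f e d"
proof -
  have "Fraction_Field.Fract 0 (f ^ e) = 0"
    using f0 by (simp add: Zero_fract_def eq_fract)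
  then show ?thesis using bounded_poleI[OF zero_polys_upto, of e] by metis
qed

lemma bounded_pole_sum:
  "(\<And>x. x \<in> A \<Longrightarrow> g x \<in> bounded_pole n f e d) \<Longrightarrow> sum g A \<in> bounded_pole n f e d"
  by (induction A rule: infinite_finite_induct) (auto simp: zero_bounded_pole bounded_pole_add)

lemma bounded_pole_scale:
  "z \<in> bounded_pole n f e d \<Longrightarrow> frac_of (Const c) * z \<in> bounded_pole n f e d"
  using bounded_pole_mult[OF bounded_pole_frac_of[OF Const_polys_upto[of c n 0]]] by simp

lemma bounded_pole_uminus: "z \<in> bounded_pole n f e d \<Longrightarrow> - z \<in> bounded_pole n f e d"
  using bounded_pole_scale[of z e d "-1"] by (simp add: single_uminus frac_of_uminus frac_of_one
    del: mult_fract minus_fract)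

lemma bounded_pole_inverse: "Fraction_Field.Fract 1 f \<in> bounded_pole n f 1 0"
  using bounded_poleI[OF Const_polys_upto[of 1 n 0], of 1] by simp

lemma bounded_pole_raise:
  assumes "z \<in> bounded_pole n f e d"
  shows "z \<in> bounded_pole n f (e + j) (d + j * b)"
proof (induction j)
  case (Suc j)
  have uf: "Fraction_Field.Fract 1 f * frac_of f = 1"
    using f0 by (simp add: One_fract_def eq_fract)
  have "Fraction_Field.Fract 1 f * (frac_of f * z) = z"
    by (simp only: mult.assoc[symmetric] uf mult_1)
  moreover have "Fraction_Field.Fract 1 f * (frac_of f * z)
      \<in> bounded_pole n f (1 + (0 + (e + j))) (0 + (b + (d + j * b)))"
    by (intro bounded_pole_mult bounded_pole_inverse bounded_pole_frac_of f Suc)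
  moreover have "1 + (0 + (e + j)) = e + Suc j" "0 + (b + (d + j * b)) = d + Suc j * b"
    by simp_all
  ultimately show ?case by (simp only:)
qed (use assms in simp)

text \<open>
  Solving the Leibniz rule for \<open>0 = D\<^sub>t(f \<cdot> (1/f))\<close> for its last term expresses \<open>f \<cdot> D\<^sub>t(1/f)\<close> by
  the products \<open>D\<^sub>s(f) \<cdot> D\<^sub>t\<^sub>-\<^sub>s(1/f)\<close> with \<open>s \<ge> 1\<close>.  By induction these are fractions with denominator
  \<open>f^(t - s + 1)\<close>; expanding them by \<open>f^(s - 1)\<close> gives all of them the denominator \<open>f^t\<close> and
  numerators of degree at most \<open>b + (t - s) b + (s - 1) b = t b\<close>.
\<close>

lemma hasse_fract_inverse_bounded_pole:
  assumes i: "i < n"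
  shows "hasse_fract t i (Fraction_Field.Fract 1 f) \<in> bounded_pole n f (t + 1) (t * b)"
proof (induction t rule: less_induct)
  case (less t)
  let ?u = "Fraction_Field.Fract 1 f"
  show ?case
  proof (cases "t = 0")
    case True
    then show ?thesis using bounded_pole_inverse by (simp add: hasse_fract_0)
  next
    case False
    let ?g = "\<lambda>s. frac_of (hasse_deriv s i f) * hasse_fract (t - s) i ?u"
    have uf: "?u * frac_of f = 1" "frac_of f * ?u = frac_of 1"
      using f0 by (simp_all add: One_fract_def eq_fract)
    have "0 = hasse_fract t i (frac_of f * ?u)"
      unfolding uf using False by (simp only: hasse_fract_frac_of hasse_deriv_one if_False frac_of_zero)
    also have "\<dots> = sum ?g {..t}"
      by (simp only: hasse_fract_mult hasse_fract_frac_of)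
    also have "{..t} = insert 0 {1..t}" by auto
    also have "sum ?g (insert 0 {1..t}) = frac_of f * hasse_fract t i ?u + sum ?g {1..t}"
      by (simp add: hasse_deriv_0)
    finally have "0 = frac_of f * hasse_fract t i ?u + sum ?g {1..t}" .
    then have "- sum ?g {1..t} = frac_of f * hasse_fract t i ?u"
      by (intro minus_unique) (rule trans[OF add.commute sym])
    then have eq: "hasse_fract t i ?u = ?u * - sum ?g {1..t}"
      by (simp only: mult.assoc[symmetric] uf(1) mult_1)
    have "?g s \<in> bounded_pole n f t (t * b)" if s: "s \<in> {1..t}" for s
    proof -
      have "hasse_deriv s i f \<in> polys_upto n b"
        using hasse_deriv_polys_upto[OF f i] by (rule polys_upto_mono) simp
      then have "?g s \<in> bounded_pole n f (0 + (t - s + 1)) (b + (t - s) * b)"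
        using s by (intro bounded_pole_mult bounded_pole_frac_of less.IH) auto
      then have "?g s \<in> bounded_pole n f (0 + (t - s + 1) + (s - 1)) (b + (t - s) * b + (s - 1) * b)"
        by (rule bounded_pole_raise)
      moreover have "0 + (t - s + 1) + (s - 1) = t" using s by auto
      moreover have "b + (t - s) * b + (s - 1) * b = (1 + (t - s) + (s - 1)) * b"
        by (simp only: distrib_right mult_1)
      moreover have "1 + (t - s) + (s - 1) = t" using s by auto
      ultimately show ?thesis by (simp only:)
    qed
    then have "- sum ?g {1..t} \<in> bounded_pole n f t (t * b)"
      by (intro bounded_pole_uminus bounded_pole_sum)
    then have "?u * - sum ?g {1..t} \<in> bounded_pole n f (1 + t) (0 + t * b)"
      by (intro bounded_pole_mult bounded_pole_inverse)
    then show ?thesis unfolding eq by simp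
  qed
qed

lemma hasse_fract_bounded_pole:
  assumes i: "i < n"
  shows "z \<in> bounded_pole n f e d \<Longrightarrow> hasse_fract t i z \<in> bounded_pole n f (e + t) (d + t * b)"
proof (induction e arbitrary: z t)
  case 0
  then obtain p where p: "z = frac_of p" "p \<in> polys_upto n d"
    by (auto simp: bounded_pole_def)
  have "hasse_deriv t i p \<in> polys_upto n d"
    using hasse_deriv_polys_upto[OF p(2) i] by (rule polys_upto_mono) simp
  then have "hasse_fract t i z \<in> bounded_pole n f 0 d"
    unfolding p(1) hasse_fract_frac_of by (rule bounded_pole_frac_of)
  then show ?case by (rule bounded_pole_raise)
next
  case (Suc e)
  then obtain p where p: "z = Fraction_Field.Fract p (f ^ Suc e)" "p \<in> polys_upto n d"
    by (auto simp: bounded_pole_def)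
  define y where "y = Fraction_Field.Fract p (f ^ e)"
  have y: "y \<in> bounded_pole n f e d" using p by (simp add: y_def bounded_poleI)
  have z: "z = Fraction_Field.Fract 1 f * y" by (simp add: p y_def)
  have "hasse_fract s i (Fraction_Field.Fract 1 f) * hasse_fract (t - s) i y
      \<in> bounded_pole n f (Suc e + t) (d + t * b)" if s: "s \<le> t" for s
  proof -
    have "hasse_fract s i (Fraction_Field.Fract 1 f) * hasse_fract (t - s) i y
        \<in> bounded_pole n f (s + 1 + (e + (t - s))) (s * b + (d + (t - s) * b))"
      by (intro bounded_pole_mult hasse_fract_inverse_bounded_pole i Suc.IH y)
    moreover have "s * b + (d + (t - s) * b) = d + (s + (t - s)) * b"
      by (simp only: distrib_right add.left_commute)
    ultimately show ?thesis using s by simp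
  qed
  then show ?case unfolding z hasse_fract_mult by (intro bounded_pole_sum) simp
qed

lemma pole_filtration:
  "diff_filtration n (\<lambda>s. bounded_pole n f s (s * (b + 1)))"
  unfolding diff_filtration_def
proof (intro conjI allI ballI impI subsetI)
  fix s t i and z assume z: "z \<in> bounded_pole n f s (s * (b + 1))"
  show "z \<in> bounded_pole n f (Suc s) (Suc s * (b + 1))"
    using bounded_pole_raise[OF z, of 1] by (auto intro: bounded_pole_mono)
  assume i: "i < n"
  have "frac_of (Var i) * z \<in> bounded_pole n f (0 + s) (1 + s * (b + 1))"
    by (intro bounded_pole_mult bounded_pole_frac_of Var_polys_upto i z)
  from bounded_pole_raise[OF this, of 1]
  have "frac_of (Var i) * z \<in> bounded_pole n f (Suc s) (1 + s * (b + 1) + b)"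
    by (simp only: add_0 mult_1 Suc_eq_plus1)
  then show "frac_of (Var i) * z \<in> bounded_pole n f (Suc s) (Suc s * (b + 1))"
    by (rule bounded_pole_mono) simp
  show "hasse_fract t i z \<in> bounded_pole n f (s + t) ((s + t) * (b + 1))"
    using hasse_fract_bounded_pole[OF i z, of t]
    by (rule bounded_pole_mono) (simp add: algebra_simps)
qed (auto simp: zero_bounded_pole bounded_pole_add bounded_pole_scale simp del: mult_fract)

lemma bounded_pole_dimension:
  "\<exists>S. finite S \<and> bounded_pole n f e d \<subseteq> kspace.span S \<and> card S \<le> (d + 1) ^ n"
proof (intro exI conjI)
  let ?g = "\<lambda>m. Fraction_Field.Fract (Poly_Mapping.single m 1) (f ^ e)"
  let ?S = "?g ` box n d"
  show "finite ?S" by (simp add: finite_box)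
  show "card ?S \<le> (d + 1) ^ n"
    using card_image_le[OF finite_box, of ?g n d] by (simp only: card_box)
  show "bounded_pole n f e d \<subseteq> kspace.span ?S"
  proof
    fix z assume "z \<in> bounded_pole n f e d"
    then obtain p where p: "z = Fraction_Field.Fract p (f ^ e)" "p \<in> polys_upto n d"
      by (auto simp: bounded_pole_def)
    let ?c = "Poly_Mapping.lookup p"
    have "z = Fraction_Field.Fract 1 (f ^ e) *
        frac_of (\<Sum>m\<in>Poly_Mapping.keys p. Poly_Mapping.single m (?c m))"
      unfolding poly_mapping_sum_single p(1) by simp
    also have "\<dots> = (\<Sum>m\<in>Poly_Mapping.keys p. frac_of (Const (?c m)) * ?g m)"
      unfolding frac_of_sum sum_distrib_left
      by (intro sum.cong refl) (simp add: mult_single)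
    also have "\<dots> \<in> kspace.span ?S"
    proof (intro kspace.span_sum kspace.span_scale kspace.span_base imageI mdeg_le_box)
      fix m assume "m \<in> Poly_Mapping.keys p"
      then show "Poly_Mapping.keys m \<subseteq> {..<n}" "mdeg n m \<le> d"
        using p(2) by (auto simp: polys_upto_def polys_def)
    qed
    finally show "z \<in> kspace.span ?S" .
  qed
qed

lemma pole_filtration_exhaustive:
  "localization n f \<subseteq> (\<Union>s. bounded_pole n f s (s * (b + 1)))"
proof
  fix z assume "z \<in> localization n f"
  then obtain p j where p: "z = Fraction_Field.Fract p (f ^ j)" "p \<in> polys n"
    by (auto simp: localization_def)
  then obtain d where "p \<in> polys_upto n d" using polys_in_polys_upto by blast
  then have "z \<in> bounded_pole n f (j + d) (d + d * b)"
    unfolding p(1) by (intro bounded_pole_raise bounded_poleI)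
  then have "z \<in> bounded_pole n f (j + d) ((j + d) * (b + 1))"
    by (rule bounded_pole_mono) (simp add: algebra_simps)
  then show "z \<in> (\<Union>s. bounded_pole n f s (s * (b + 1)))" by blast
qed

lemma hasse_fract_localization:
  assumes "i < n" "z \<in> localization n f"
  shows "hasse_fract t i z \<in> localization n f"
proof -
  obtain s where "z \<in> bounded_pole n f s (s * (b + 1))"
    using assms(2) pole_filtration_exhaustive by blast
  then have "hasse_fract t i z \<in> bounded_pole n f (s + t) (s * (b + 1) + t * b)"
    by (rule hasse_fract_bounded_pole[OF assms(1)])
  then show ?thesis
    by (auto simp: bounded_pole_def localization_def polys_upto_def)
qed

end

section \<open>The ring of differential operators\<close>

lemma polys_uminus: "p \<in> polys n \<Longrightarrow> - p \<in> polys n"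
  by (auto simp: polys_def in_keys_iff)

lemma zero_polys: "0 \<in> polys n"
  by (simp add: polys_def)

lemma one_polys: "1 \<in> polys n"
  using polys_Const[of 1 n] by simp

lemma polys_power: "p \<in> polys n \<Longrightarrow> p ^ j \<in> polys n"
  by (induction j) (simp_all add: one_polys polys_mult)

lemma EndD:
  assumes "\<phi> \<in> carrier (End_polys n)"
  shows "p \<in> polys n \<Longrightarrow> \<phi> p \<in> polys n"
    and "p \<in> polys n \<Longrightarrow> q \<in> polys n \<Longrightarrow> \<phi> (p + q) = \<phi> p + \<phi> q"
    and "p \<in> polys n \<Longrightarrow> \<phi> (Const c * p) = Const c * \<phi> p"
    and "p \<notin> polys n \<Longrightarrow> \<phi> p = undefined"
  using assms by (auto simp: End_polys_def PiE_def Pi_def extensional_def)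

lemma EndI:
  assumes "\<And>p. p \<in> polys n \<Longrightarrow> g p \<in> polys n"
    and "\<And>p q. p \<in> polys n \<Longrightarrow> q \<in> polys n \<Longrightarrow> g (p + q) = g p + g q"
    and "\<And>c p. p \<in> polys n \<Longrightarrow> g (Const c * p) = Const c * g p"
  shows "restrict g (polys n) \<in> carrier (End_polys n)"
  using assms by (auto simp: End_polys_def polys_add polys_mult polys_Const)

lemma End_eqI:
  assumes "\<phi> \<in> carrier (End_polys n)" "\<psi> \<in> carrier (End_polys n)"
    and "\<And>p. p \<in> polys n \<Longrightarrow> \<phi> p = \<psi> p"
  shows "\<phi> = \<psi>"
proof
  fix p show "\<phi> p = \<psi> p"
    using assms(3) EndD(4)[OF assms(1)] EndD(4)[OF assms(2)] by (cases "p \<in> polys n") auto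
qed

lemma End_ops:
  "\<one>\<^bsub>End_polys n\<^esub> = restrict (\<lambda>p. p) (polys n)"
  "\<zero>\<^bsub>End_polys n\<^esub> = restrict (\<lambda>p. 0) (polys n)"
  "\<phi> \<otimes>\<^bsub>End_polys n\<^esub> \<psi> = restrict (\<lambda>p. \<phi> (\<psi> p)) (polys n)"
  "\<phi> \<oplus>\<^bsub>End_polys n\<^esub> \<psi> = restrict (\<lambda>p. \<phi> p + \<psi> p) (polys n)"
  by (simp_all add: End_polys_def compose_def)

lemma End_closed:
  assumes "\<phi> \<in> carrier (End_polys n)" "\<psi> \<in> carrier (End_polys n)"
  shows "\<one>\<^bsub>End_polys n\<^esub> \<in> carrier (End_polys n)"
    and "\<zero>\<^bsub>End_polys n\<^esub> \<in> carrier (End_polys n)"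
    and "\<phi> \<otimes>\<^bsub>End_polys n\<^esub> \<psi> \<in> carrier (End_polys n)"
    and "\<phi> \<oplus>\<^bsub>End_polys n\<^esub> \<psi> \<in> carrier (End_polys n)"
    and "restrict (\<lambda>p. - \<phi> p) (polys n) \<in> carrier (End_polys n)"
  unfolding End_ops
  by (rule EndI; simp add: EndD[OF assms(1)] EndD[OF assms(2)] zero_polys polys_add polys_uminus
    polys_mult polys_Const distrib_left add_ac)+

lemma ring_End_polys: "ring (End_polys n :: ('k::field mpol \<Rightarrow> 'k mpol) ring)"
proof (rule ringI)
  let ?E = "End_polys n :: ('k mpol \<Rightarrow> 'k mpol) ring"
  note simps = End_ops EndD polys_add polys_mult zero_polys polys_uminus
  show "abelian_group ?E"
  proof (rule abelian_groupI)
    fix x y z assume xyz: "x \<in> carrier ?E" "y \<in> carrier ?E" "z \<in> carrier ?E"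
    show "x \<oplus>\<^bsub>?E\<^esub> y \<oplus>\<^bsub>?E\<^esub> z = x \<oplus>\<^bsub>?E\<^esub> (y \<oplus>\<^bsub>?E\<^esub> z)"
      using xyz by (intro End_eqI[of _ n] End_closed) (simp_all add: simps add.assoc)
  next
    fix x y assume xy: "x \<in> carrier ?E" "y \<in> carrier ?E"
    show "x \<oplus>\<^bsub>?E\<^esub> y = y \<oplus>\<^bsub>?E\<^esub> x"
      using xy by (intro End_eqI[of _ n] End_closed) (simp_all add: simps add.commute)
    show "x \<oplus>\<^bsub>?E\<^esub> y \<in> carrier ?E" using xy by (rule End_closed)
  next
    fix x assume x: "x \<in> carrier ?E"
    show "\<zero>\<^bsub>?E\<^esub> \<oplus>\<^bsub>?E\<^esub> x = x"
      using x by (intro End_eqI[of _ n] End_closed) (simp_all add: simps)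
    show "\<exists>y\<in>carrier ?E. y \<oplus>\<^bsub>?E\<^esub> x = \<zero>\<^bsub>?E\<^esub>"
    proof
      show neg: "restrict (\<lambda>p. - x p) (polys n) \<in> carrier ?E" using x by (rule End_closed) fact
      show "restrict (\<lambda>p. - x p) (polys n) \<oplus>\<^bsub>?E\<^esub> x = \<zero>\<^bsub>?E\<^esub>"
        using x neg by (intro End_eqI[of _ n] End_closed) (simp_all add: simps)
    qed
  next
    have "mult_op n 0 \<in> carrier ?E" by (rule mult_op_End[OF zero_polys])
    then show "\<zero>\<^bsub>?E\<^esub> \<in> carrier ?E" by (rule End_closed) fact
  qed
  show "Group.monoid ?E"
  proof (rule monoidI)
    fix x y z assume xyz: "x \<in> carrier ?E" "y \<in> carrier ?E" "z \<in> carrier ?E"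
    show "x \<otimes>\<^bsub>?E\<^esub> y \<otimes>\<^bsub>?E\<^esub> z = x \<otimes>\<^bsub>?E\<^esub> (y \<otimes>\<^bsub>?E\<^esub> z)"
      using xyz by (intro End_eqI[of _ n] End_closed) (simp_all add: simps)
  next
    fix x y assume xy: "x \<in> carrier ?E" "y \<in> carrier ?E"
    show "x \<otimes>\<^bsub>?E\<^esub> y \<in> carrier ?E" using xy by (rule End_closed)
  next
    fix x assume x: "x \<in> carrier ?E"
    show "\<one>\<^bsub>?E\<^esub> \<otimes>\<^bsub>?E\<^esub> x = x" "x \<otimes>\<^bsub>?E\<^esub> \<one>\<^bsub>?E\<^esub> = x"
      using x by (intro End_eqI[of _ n] End_closed; simp add: simps)+
  next
    have "mult_op n 0 \<in> carrier ?E" by (rule mult_op_End[OF zero_polys])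
    then show "\<one>\<^bsub>?E\<^esub> \<in> carrier ?E" by (rule End_closed) fact
  qed
  fix x y z assume xyz: "x \<in> carrier ?E" "y \<in> carrier ?E" "z \<in> carrier ?E"
  show "(x \<oplus>\<^bsub>?E\<^esub> y) \<otimes>\<^bsub>?E\<^esub> z = x \<otimes>\<^bsub>?E\<^esub> z \<oplus>\<^bsub>?E\<^esub> y \<otimes>\<^bsub>?E\<^esub> z"
    using xyz by (intro End_eqI[of _ n] End_closed) (simp_all add: simps)
  show "z \<otimes>\<^bsub>?E\<^esub> (x \<oplus>\<^bsub>?E\<^esub> y) = z \<otimes>\<^bsub>?E\<^esub> x \<oplus>\<^bsub>?E\<^esub> z \<otimes>\<^bsub>?E\<^esub> y"
    using xyz by (intro End_eqI[of _ n] End_closed) (simp_all add: simps)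
qed

lemma End_a_inv:
  assumes "\<phi> \<in> carrier (End_polys n)"
  shows "\<ominus>\<^bsub>End_polys n\<^esub> \<phi> = restrict (\<lambda>p. - \<phi> p) (polys n)"
proof -
  interpret E: ring "End_polys n" by (rule ring_End_polys)
  have neg: "restrict (\<lambda>p. - \<phi> p) (polys n) \<in> carrier (End_polys n)"
    using assms assms by (rule End_closed)
  have "restrict (\<lambda>p. - \<phi> p) (polys n) \<oplus>\<^bsub>End_polys n\<^esub> \<phi> = \<zero>\<^bsub>End_polys n\<^esub>"
    by (auto simp: End_ops)
  then show ?thesis using assms neg by (intro E.minus_equality)
qed

abbreviation diff_op_generators :: "nat \<Rightarrow> ('k::field mpol \<Rightarrow> 'k mpol) set" where
  "diff_op_generators n \<equiv> mult_op n ` polys n \<union> {deriv_op n t i | t i. i < n}"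

lemma diff_op_generators_subset: "diff_op_generators n \<subseteq> carrier (End_polys n)"
  using mult_op_End deriv_op_End by blast

lemma diff_ops_carrier: "carrier (diff_ops n) = generate_ring (End_polys n) (diff_op_generators n)"
  by (simp add: diff_ops_def)

lemma diff_ops_ops:
  "P \<otimes>\<^bsub>diff_ops n\<^esub> Q = P \<otimes>\<^bsub>End_polys n\<^esub> Q" "P \<oplus>\<^bsub>diff_ops n\<^esub> Q = P \<oplus>\<^bsub>End_polys n\<^esub> Q"
  "\<one>\<^bsub>diff_ops n\<^esub> = \<one>\<^bsub>End_polys n\<^esub>" "\<zero>\<^bsub>diff_ops n\<^esub> = \<zero>\<^bsub>End_polys n\<^esub>"
  by (simp_all add: diff_ops_def)

lemma ring_diff_ops: "ring (diff_ops n :: ('k::field mpol \<Rightarrow> 'k mpol) ring)"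
  unfolding diff_ops_def by (rule ring.generate_ring_is_ring[OF ring_End_polys diff_op_generators_subset])

lemma diff_ops_End: "P \<in> carrier (diff_ops n) \<Longrightarrow> P \<in> carrier (End_polys n)"
  unfolding diff_ops_carrier by (rule ring.generate_ring_in_carrier[OF ring_End_polys diff_op_generators_subset])

lemma mult_op_diff_ops: "r \<in> polys n \<Longrightarrow> mult_op n r \<in> carrier (diff_ops n)"
  unfolding diff_ops_carrier by (rule generate_ring.incl) blast

lemma deriv_op_diff_ops: "i < n \<Longrightarrow> deriv_op n t i \<in> carrier (diff_ops n)"
  unfolding diff_ops_carrier by (rule generate_ring.incl) blast

section \<open>Operators with nilpotent commutators\<close>

definition commutator :: "'a \<Rightarrow> ('a \<Rightarrow> 'a) \<Rightarrow> 'a \<Rightarrow> 'a::comm_ring_1" where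
  "commutator g P = (\<lambda>z. g * P z - P (g * z))"

text \<open>
  Differential operators of order less than \<open>N\<close> satisfy this for every \<open>g\<close>, by Grothendieck's
  description.  Only commutators with one fixed element are iterated here.
\<close>

definition ad_nilpotent :: "'a::comm_ring_1 \<Rightarrow> ('a \<Rightarrow> 'a) \<Rightarrow> bool" where
  "ad_nilpotent g P \<longleftrightarrow> (\<exists>N. (commutator g ^^ N) P = (\<lambda>_. 0))"

lemma commutator_add: "commutator g (\<lambda>z. P z + Q z) = (\<lambda>z. commutator g P z + commutator g Q z)"
  by (simp add: commutator_def algebra_simps)

lemma commutator_uminus: "commutator g (\<lambda>z. - P z) = (\<lambda>z. - commutator g P z)"
  by (simp add: commutator_def)

lemma commutator_zero: "commutator g (\<lambda>_. 0) = (\<lambda>_. 0)"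
  by (simp add: commutator_def)

lemma commutator_power_add:
  "(commutator g ^^ N) (\<lambda>z. P z + Q z) = (\<lambda>z. (commutator g ^^ N) P z + (commutator g ^^ N) Q z)"
  by (induction N) (simp_all add: commutator_add)

lemma commutator_power_uminus:
  "(commutator g ^^ N) (\<lambda>z. - P z) = (\<lambda>z. - (commutator g ^^ N) P z)"
  by (induction N) (simp_all add: commutator_uminus)

lemma commutator_power_zero: "(commutator g ^^ N) (\<lambda>_. 0) = (\<lambda>_. 0)"
  by (induction N) (simp_all add: commutator_zero)

lemma commutator_power_stays_zero:
  "(commutator g ^^ N) P = (\<lambda>_. 0) \<Longrightarrow> N \<le> M \<Longrightarrow> (commutator g ^^ M) P = (\<lambda>_. 0)"
  using funpow_add[of "M - N" N "commutator g"] by (simp add: commutator_power_zero)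

lemma ad_nilpotent_add:
  assumes "ad_nilpotent g P" "ad_nilpotent g Q"
  shows "ad_nilpotent g (\<lambda>z. P z + Q z)"
proof -
  obtain N M where "(commutator g ^^ N) P = (\<lambda>_. 0)" "(commutator g ^^ M) Q = (\<lambda>_. 0)"
    using assms by (auto simp: ad_nilpotent_def)
  then have "(commutator g ^^ max N M) P = (\<lambda>_. 0)" "(commutator g ^^ max N M) Q = (\<lambda>_. 0)"
    by (auto intro: commutator_power_stays_zero)
  then have "(commutator g ^^ max N M) (\<lambda>z. P z + Q z) = (\<lambda>_. 0)"
    by (simp add: commutator_power_add)
  then show ?thesis by (auto simp: ad_nilpotent_def)
qed

lemma ad_nilpotent_zero: "ad_nilpotent g (\<lambda>_. 0)"
  unfolding ad_nilpotent_def by (rule exI[of _ 0]) simp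

lemma ad_nilpotent_uminus: "ad_nilpotent g P \<Longrightarrow> ad_nilpotent g (\<lambda>z. - P z)"
  by (auto simp: ad_nilpotent_def commutator_power_uminus) (auto simp: fun_eq_iff)

lemma ad_nilpotent_sum:
  "(\<And>x. x \<in> A \<Longrightarrow> ad_nilpotent g (P x)) \<Longrightarrow> ad_nilpotent g (\<lambda>z. \<Sum>x\<in>A. P x z)"
  by (induction A rule: infinite_finite_induct) (simp_all add: ad_nilpotent_zero ad_nilpotent_add)

lemma ad_nilpotent_commutator: "ad_nilpotent g (commutator g P) \<Longrightarrow> ad_nilpotent g P"
  unfolding ad_nilpotent_def by (metis comp_apply funpow_Suc_right)

lemma ad_nilpotent_mult: "ad_nilpotent g (\<lambda>z. r * z)"
  by (rule ad_nilpotent_commutator) (simp add: commutator_def algebra_simps ad_nilpotent_zero)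

lemma additive_commutator:
  assumes "\<And>y z. P (y + z) = P y + P z"
  shows "commutator g P (y + z) = commutator g P y + commutator g P z"
  by (simp add: commutator_def assms algebra_simps)

text \<open>
  The commutator with \<open>g\<close> is a derivation with respect to composition, so \<open>N + M\<close> commutators
  with \<open>P \<circ> Q\<close> leave only terms in which \<open>N\<close> of them fall on \<open>P\<close> or \<open>M\<close> of them on \<open>Q\<close>.
\<close>

lemma commutator_power_compose:
  assumes "\<And>y z. P (y + z) = P y + P z" "\<And>y z. Q (y + z) = Q y + Q z"
    "(commutator g ^^ N) P = (\<lambda>_. 0)" "(commutator g ^^ M) Q = (\<lambda>_. 0)"
  shows "(commutator g ^^ (N + M)) (\<lambda>z. P (Q z)) = (\<lambda>_. 0)"
  using assms
proof (induction "N + M" arbitrary: N M P Q rule: less_induct)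
  case less
  have P0: "P 0 = 0" using less.prems(1)[of 0 0] by simp
  show ?case
  proof (cases "N = 0 \<or> M = 0")
    case True
    then have "(\<lambda>z. P (Q z)) = (\<lambda>_. 0)" using less.prems(3,4) P0 by (auto simp: fun_eq_iff)
    then show ?thesis by (simp only: commutator_power_zero)
  next
    case False
    then obtain N' M' where NM: "N = Suc N'" "M = Suc M'" by (metis not0_implies_Suc)
    have diff: "P (y - z) = P y - P z" for y z
      using less.prems(1)[of "y - z" z] by simp
    have "commutator g (\<lambda>z. P (Q z)) = (\<lambda>z. commutator g P (Q z) + P (commutator g Q z))"
      by (simp add: commutator_def diff fun_eq_iff)
    moreover have "(commutator g ^^ (N' + M)) (\<lambda>z. commutator g P (Q z)) = (\<lambda>_. 0)"
      using less.prems NM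
      by (intro less.hyps additive_commutator) (simp_all add: funpow_swap1)
    moreover have "(commutator g ^^ (N + M')) (\<lambda>z. P (commutator g Q z)) = (\<lambda>_. 0)"
      using less.prems NM
      by (intro less.hyps additive_commutator) (simp_all add: funpow_swap1)
    moreover have "N' + M = N + M'" "N + M = Suc (N + M')" using NM by simp_all
    ultimately show ?thesis
      by (simp only: funpow_Suc_right comp_apply commutator_power_add) simp
  qed
qed

lemma ad_nilpotent_compose:
  assumes "\<And>y z. P (y + z) = P y + P z" "\<And>y z. Q (y + z) = Q y + Q z"
    "ad_nilpotent g P" "ad_nilpotent g Q"
  shows "ad_nilpotent g (\<lambda>z. P (Q z))"
proof -
  obtain N M where "(commutator g ^^ N) P = (\<lambda>_. 0)" "(commutator g ^^ M) Q = (\<lambda>_. 0)"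
    using assms(3,4) by (auto simp: ad_nilpotent_def)
  then have "(commutator g ^^ (N + M)) (\<lambda>z. P (Q z)) = (\<lambda>_. 0)"
    by (rule commutator_power_compose[OF assms(1,2)])
  then show ?thesis unfolding ad_nilpotent_def ..
qed

text \<open>
  By the Leibniz rule the commutator of \<open>D\<^sub>t\<^sub>,\<^sub>i\<close> with \<open>g\<close> is a combination of operators \<open>D\<^sub>t\<^sub>-\<^sub>s\<^sub>,\<^sub>i\<close>
  with \<open>s \<ge> 1\<close>.
\<close>

lemma ad_nilpotent_hasse_fract: "ad_nilpotent g (hasse_fract t i)"
proof (induction t rule: less_induct)
  case (less t)
  have "commutator g (hasse_fract t i) z =
      - (\<Sum>s\<in>{1..t}. hasse_fract s i g * hasse_fract (t - s) i z)" for z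
  proof -
    have "hasse_fract t i (g * z) = (\<Sum>s\<in>insert 0 {1..t}. hasse_fract s i g * hasse_fract (t - s) i z)"
      unfolding hasse_fract_mult by (intro sum.cong) auto
    then show ?thesis by (simp add: commutator_def hasse_fract_0)
  qed
  then have "commutator g (hasse_fract t i) =
      (\<lambda>z. - (\<Sum>s\<in>{1..t}. hasse_fract s i g * hasse_fract (t - s) i z))" by blast
  moreover have "ad_nilpotent g (\<lambda>z. - (\<Sum>s\<in>{1..t}. hasse_fract s i g * hasse_fract (t - s) i z))"
  proof (intro ad_nilpotent_uminus ad_nilpotent_sum)
    fix s assume "s \<in> {1..t}"
    then have nil: "ad_nilpotent g (hasse_fract (t - s) i)" by (intro less.IH) auto
    show "ad_nilpotent g (\<lambda>z. hasse_fract s i g * hasse_fract (t - s) i z)"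
      by (rule ad_nilpotent_compose[of "\<lambda>z. hasse_fract s i g * z" "hasse_fract (t - s) i",
            OF _ _ ad_nilpotent_mult nil])
         (simp_all only: hasse_fract_add distrib_left)
  qed
  ultimately show ?case by (metis ad_nilpotent_commutator)
qed

section \<open>The natural action on the localization\<close>

context
  fixes n :: nat and f :: "'k::field mpol"
  assumes f: "f \<in> polys n" and f0: "f \<noteq> 0"
begin

lemma localizationI: "p \<in> polys n \<Longrightarrow> Fraction_Field.Fract p (f ^ j) \<in> localization n f"
  by (auto simp: localization_def)

lemma localization_frac_of: "p \<in> polys n \<Longrightarrow> frac_of p \<in> localization n f"
  using localizationI[of p 0] by simp

lemma localization_mult_poly:
  assumes "p \<in> polys n" "z \<in> localization n f"
  shows "frac_of p * z \<in> localization n f"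
proof -
  obtain m j where "m \<in> polys n" "z = Fraction_Field.Fract m (f ^ j)"
    using assms(2) by (auto simp: localization_def)
  then show ?thesis using localizationI[OF polys_mult[OF assms(1)], of m j] by simp
qed

lemma localization_add:
  assumes "y \<in> localization n f" "z \<in> localization n f"
  shows "y + z \<in> localization n f"
proof -
  obtain p j q l where "p \<in> polys n" "q \<in> polys n" "y = Fraction_Field.Fract p (f ^ j)"
      "z = Fraction_Field.Fract q (f ^ l)"
    using assms by (auto simp: localization_def)
  then have "y + z = Fraction_Field.Fract (p * f ^ l + q * f ^ j) (f ^ (j + l))"
      "p * f ^ l + q * f ^ j \<in> polys n"
    using f0 f by (simp_all add: power_add polys_add polys_mult polys_power)
  then show ?thesis using localizationI by simp
qed

lemma localization_uminus: "z \<in> localization n f \<Longrightarrow> - z \<in> localization n f"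
  by (auto simp: localization_def) (metis polys_uminus)

lemma hasse_fract_in_localization:
  "i < n \<Longrightarrow> z \<in> localization n f \<Longrightarrow> hasse_fract t i z \<in> localization n f"
  using polys_in_polys_upto[OF f] hasse_fract_localization[OF _ f0] by metis

text \<open>
  By induction on \<open>N\<close> the commutator of \<open>Q\<close> with \<open>f\<close> vanishes on the localization as well, that
  is, \<open>Q\<close> commutes with \<open>f\<close>.  Then \<open>f^j Q(p / f^j) = Q(p) = 0\<close>.
\<close>

lemma vanishes_on_localization:
  assumes "\<And>p. p \<in> polys n \<Longrightarrow> Q (frac_of p) = 0"
    and "(commutator (frac_of f) ^^ N) Q = (\<lambda>_. 0)"
  shows "z \<in> localization n f \<Longrightarrow> Q z = 0"
  using assms
proof (induction N arbitrary: Q z)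
  case (Suc N)
  have "commutator (frac_of f) Q y = 0" if "y \<in> localization n f" for y
  proof (rule Suc.IH[OF that])
    fix p :: "'k mpol" assume p: "p \<in> polys n"
    show "commutator (frac_of f) Q (frac_of p) = 0"
      using Suc.prems(2)[OF p] Suc.prems(2)[OF polys_mult[OF f p]] by (simp add: commutator_def)
  next
    show "(commutator (frac_of f) ^^ N) (commutator (frac_of f) Q) = (\<lambda>_. 0)"
      using Suc.prems(3) by (simp add: funpow_swap1)
  qed
  then have comm: "Q (frac_of f * y) = frac_of f * Q y" if "y \<in> localization n f" for y
    using that by (simp add: commutator_def)
  have "Q (Fraction_Field.Fract p (f ^ j)) = 0" if p: "p \<in> polys n" for p j
  proof (induction j)
    case 0
    then show ?case using Suc.prems(2)[OF p] by simp
  next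
    case (Suc j)
    have "frac_of f * Fraction_Field.Fract p (f ^ Suc j) = Fraction_Field.Fract p (f ^ j)"
      using f0 by (simp add: eq_fract)
    then have "frac_of f * Q (Fraction_Field.Fract p (f ^ Suc j)) = 0"
      using comm[OF localizationI[OF p]] Suc by metis
    then show ?case using f0 frac_of_eq_0_iff[of f] by (metis mult_eq_0_iff)
  qed
  then show ?case using Suc.prems(1) by (auto simp: localization_def)
qed simp

text \<open>
  The additivity and the nilpotency make \<open>Q\<close> unique on the localization.  The relation is
  compatible with all ring operations, so it carries the ring structure of \<open>\<D>\<close> over to the
  extensions without a normal form for differential operators.
\<close>

definition extends_op :: "('k mpol \<Rightarrow> 'k mpol) \<Rightarrow> ('k mpol fract \<Rightarrow> 'k mpol fract) \<Rightarrow> bool" where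
  "extends_op P Q \<longleftrightarrow> (\<forall>y z. Q (y + z) = Q y + Q z) \<and> ad_nilpotent (frac_of f) Q \<and>
     (\<forall>p\<in>polys n. Q (frac_of p) = frac_of (P p)) \<and> (\<forall>z\<in>localization n f. Q z \<in> localization n f)"

lemma extends_op_unique:
  assumes "extends_op P Q" "extends_op P Q'" "z \<in> localization n f"
  shows "Q z = Q' z"
proof -
  have "ad_nilpotent (frac_of f) (\<lambda>z. Q z + - Q' z)"
    using assms by (intro ad_nilpotent_add ad_nilpotent_uminus) (auto simp: extends_op_def)
  then obtain N where "(commutator (frac_of f) ^^ N) (\<lambda>z. Q z + - Q' z) = (\<lambda>_. 0)"
    by (auto simp: ad_nilpotent_def)
  then have "Q z + - Q' z = 0"
    using assms by (intro vanishes_on_localization[of "\<lambda>z. Q z + - Q' z" N z])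
      (auto simp: extends_op_def frac_of_zero)
  then show ?thesis by simp
qed

lemma extends_op_mult_op: "r \<in> polys n \<Longrightarrow> extends_op (mult_op n r) (\<lambda>z. frac_of r * z)"
  unfolding extends_op_def
  by (simp add: distrib_left ad_nilpotent_mult mult_op_def frac_of_mult localization_mult_poly
    del: mult_fract)

lemma extends_op_deriv_op: "i < n \<Longrightarrow> extends_op (deriv_op n t i) (hasse_fract t i)"
  unfolding extends_op_def
  by (simp add: hasse_fract_add ad_nilpotent_hasse_fract deriv_op_def hasse_fract_frac_of
    hasse_fract_in_localization)

lemma extends_op_add:
  assumes "extends_op P Q" "extends_op P' Q'"
  shows "extends_op (P \<oplus>\<^bsub>End_polys n\<^esub> P') (\<lambda>z. Q z + Q' z)"
  using assms unfolding extends_op_def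
  by (auto simp: End_ops localization_add intro: ad_nilpotent_add)

lemma extends_op_uminus:
  assumes "extends_op P Q" "P \<in> carrier (End_polys n)"
  shows "extends_op (\<ominus>\<^bsub>End_polys n\<^esub> P) (\<lambda>z. - Q z)"
  using assms(1) unfolding extends_op_def End_a_inv[OF assms(2)]
  by (auto simp: localization_uminus intro: ad_nilpotent_uminus)

lemma extends_op_compose:
  assumes "extends_op P Q" "extends_op P' Q'" "P' \<in> carrier (End_polys n)"
  shows "extends_op (P \<otimes>\<^bsub>End_polys n\<^esub> P') (\<lambda>z. Q (Q' z))"
proof -
  have "ad_nilpotent (frac_of f) (\<lambda>z. Q (Q' z))"
    using assms(1,2) unfolding extends_op_def
    by (intro ad_nilpotent_compose[of Q Q']) auto
  then show ?thesis
    using assms(1,2) EndD(1)[OF assms(3)] unfolding extends_op_def by (auto simp: End_ops)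
qed

lemma extends_op_one: "extends_op \<one>\<^bsub>End_polys n\<^esub> (\<lambda>z. z)"
  using ad_nilpotent_mult[of "frac_of f" 1] unfolding extends_op_def by (simp add: End_ops)

lemma extends_op_exists: "P \<in> carrier (diff_ops n) \<Longrightarrow> \<exists>Q. extends_op P Q"
  unfolding diff_ops_carrier
proof (induction rule: generate_ring.induct)
  case one
  then show ?case using extends_op_one by blast
next
  case (incl h)
  then show ?case using extends_op_mult_op extends_op_deriv_op by blast
next
  case (a_inv h)
  then show ?case using extends_op_uminus diff_ops_End diff_ops_carrier by blast
next
  case (eng_add h1 h2)
  then show ?case using extends_op_add by blast
next
  case (eng_mult h1 h2)
  then show ?case using extends_op_compose diff_ops_End diff_ops_carrier by blast
qed

definition extension_action :: "('k mpol \<Rightarrow> 'k mpol) \<Rightarrow> 'k mpol fract \<Rightarrow> 'k mpol fract" where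
  "extension_action P = (SOME Q. extends_op P Q)"

lemma extends_op_extension_action:
  "P \<in> carrier (diff_ops n) \<Longrightarrow> extends_op P (extension_action P)"
  unfolding extension_action_def using extends_op_exists by (rule someI_ex)

lemma extension_action_eq:
  "P \<in> carrier (diff_ops n) \<Longrightarrow> extends_op P Q \<Longrightarrow> z \<in> localization n f \<Longrightarrow> extension_action P z = Q z"
  using extends_op_unique[OF extends_op_extension_action] .

lemma abelian_group_loc_module: "abelian_group (loc_module n f act)"
proof (rule abelian_groupI)
  fix x assume "x \<in> carrier (loc_module n f act)"
  then show "\<exists>y\<in>carrier (loc_module n f act). y \<oplus>\<^bsub>loc_module n f act\<^esub> x = \<zero>\<^bsub>loc_module n f act\<^esub>"
    by (intro bexI[of _ "- x"]) (auto simp: loc_module_def localization_uminus)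
next
  show "\<zero>\<^bsub>loc_module n f act\<^esub> \<in> carrier (loc_module n f act)"
    using localization_frac_of[OF zero_polys] by (simp add: loc_module_def frac_of_zero)
qed (auto simp: loc_module_def localization_add)

lemma left_module_extension_action:
  "left_module (diff_ops n) (loc_module n f extension_action)"
proof -
  interpret D: ring "diff_ops n :: ('k mpol \<Rightarrow> 'k mpol) ring" by (rule ring_diff_ops)
  note ext = extends_op_extension_action
  have ops: "carrier (loc_module n f extension_action) = localization n f"
    "P \<odot>\<^bsub>loc_module n f extension_action\<^esub> z = extension_action P z"
    "y \<oplus>\<^bsub>loc_module n f extension_action\<^esub> z = y + z" for P y z
    by (simp_all add: loc_module_def)
  show ?thesis
  proof (intro left_module.intro left_module_axioms.intro ring_diff_ops abelian_group_loc_module;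
      unfold ops)
    fix a b :: "'k mpol \<Rightarrow> 'k mpol" and x y :: "'k mpol fract"
    assume a: "a \<in> carrier (diff_ops n)"
    show "extension_action a x \<in> localization n f" if "x \<in> localization n f"
      using ext[OF a] that by (auto simp: extends_op_def)
    show "extension_action a (x + y) = extension_action a x + extension_action a y"
      using ext[OF a] by (auto simp: extends_op_def)
    assume b: "b \<in> carrier (diff_ops n)" and x: "x \<in> localization n f"
    show "extension_action (a \<oplus>\<^bsub>diff_ops n\<^esub> b) x = extension_action a x + extension_action b x"
      using extends_op_add[OF ext[OF a] ext[OF b]] D.a_closed[OF a b]
      by (intro extension_action_eq x) (simp_all add: diff_ops_ops)
    show "extension_action (a \<otimes>\<^bsub>diff_ops n\<^esub> b) x = extension_action a (extension_action b x)"
      using extends_op_compose[OF ext[OF a] ext[OF b] diff_ops_End[OF b]] D.m_closed[OF a b]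
      by (intro extension_action_eq x) (simp_all add: diff_ops_ops)
  next
    fix x :: "'k mpol fract" assume x: "x \<in> localization n f"
    show "extension_action \<one>\<^bsub>diff_ops n\<^esub> x = x"
      using extends_op_one D.one_closed
      by (intro extension_action_eq x) (simp_all add: diff_ops_ops)
  qed
qed

lemma natural_action_extension_action: "natural_action n f extension_action"
  unfolding natural_action_def
proof (intro conjI ballI allI impI left_module_extension_action)
  fix r :: "'k mpol" and z :: "'k mpol fract" assume "r \<in> polys n" "z \<in> localization n f"
  then show "extension_action (mult_op n r) z = frac_of r * z"
    by (intro extension_action_eq mult_op_diff_ops extends_op_mult_op)
next
  fix t i j and m :: "'k mpol" assume i: "i < n" and m: "m \<in> polys n"
  have ext: "extension_action (deriv_op n s i) (Fraction_Field.Fract m (f ^ j)) =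
      hasse_fract s i (Fraction_Field.Fract m (f ^ j))" for s
    by (intro extension_action_eq deriv_op_diff_ops extends_op_deriv_op localizationI i m)
  show "extension_action (deriv_op n t i) (Fraction_Field.Fract m (f ^ j)) =
      Fraction_Field.Fract 1 (f ^ j) * frac_of (deriv_op n t i m) -
      (\<Sum>s = 1..t. Fraction_Field.Fract 1 (f ^ j) * frac_of (deriv_op n s i (f ^ j)) *
         extension_action (deriv_op n (t - s) i) (Fraction_Field.Fract m (f ^ j)))"
    unfolding ext using hasse_fract_recursion[OF f0, of t i m j] m polys_power[OF f]
    by (simp add: deriv_op_def del: mult_fract)
qed

text \<open>
  The operators \<open>D\<^sub>t\<^sub>,\<^sub>i\<close> act in the same way in every natural action, because the recursion
  determines them.
\<close>

lemma natural_action_deriv: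
  assumes act: "natural_action n f act" and i: "i < n" and z: "z \<in> localization n f"
  shows "act (deriv_op n t i) z = hasse_fract t i z"
proof (induction t rule: less_induct)
  case (less t)
  obtain m j where m: "z = Fraction_Field.Fract m (f ^ j)" "m \<in> polys n"
    using z by (auto simp: localization_def)
  have "act (deriv_op n t i) z = Fraction_Field.Fract 1 (f ^ j) * frac_of (deriv_op n t i m)
      - (\<Sum>s = 1..t. Fraction_Field.Fract 1 (f ^ j) * frac_of (deriv_op n s i (f ^ j)) *
         act (deriv_op n (t - s) i) z)"
    using act i m unfolding natural_action_def by blast
  also have "(\<Sum>s = 1..t. Fraction_Field.Fract 1 (f ^ j) * frac_of (deriv_op n s i (f ^ j)) *
         act (deriv_op n (t - s) i) z) =
      (\<Sum>s = 1..t. Fraction_Field.Fract 1 (f ^ j) * frac_of (hasse_deriv s i (f ^ j)) *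
         hasse_fract (t - s) i z)"
  proof (intro sum.cong refl)
    fix s assume "s \<in> {1..t}"
    then have "act (deriv_op n (t - s) i) z = hasse_fract (t - s) i z"
      by (intro less.IH) auto
    moreover have "deriv_op n s i (f ^ j) = hasse_deriv s i (f ^ j)"
      using polys_power[OF f] by (simp add: deriv_op_def)
    ultimately show "Fraction_Field.Fract 1 (f ^ j) * frac_of (deriv_op n s i (f ^ j)) *
         act (deriv_op n (t - s) i) z =
        Fraction_Field.Fract 1 (f ^ j) * frac_of (hasse_deriv s i (f ^ j)) *
         hasse_fract (t - s) i z"
      by (simp only:)
  qed
  also have "frac_of (deriv_op n t i m) = frac_of (hasse_deriv t i m)"
    using m by (simp add: deriv_op_def)
  also have "Fraction_Field.Fract 1 (f ^ j) * frac_of (hasse_deriv t i m)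
      - (\<Sum>s = 1..t. Fraction_Field.Fract 1 (f ^ j) * frac_of (hasse_deriv s i (f ^ j)) *
         hasse_fract (t - s) i z) = hasse_fract t i z"
    unfolding m(1) by (rule hasse_fract_recursion[OF f0, symmetric])
  finally show ?case .
qed

end

section \<open>Finite length\<close>

text \<open>
  A composition series is a chain of this kind that cannot be refined.
\<close>

definition submodule_chain ::
    "('a, 'c) ring_scheme \<Rightarrow> ('a, 'b, 'd) module_scheme \<Rightarrow> nat \<Rightarrow> (nat \<Rightarrow> 'b set) \<Rightarrow> bool" where
  "submodule_chain R M l N \<longleftrightarrow> N 0 = {\<zero>\<^bsub>M\<^esub>} \<and> N l = carrier M \<and>
     (\<forall>i \<le> l. submodule (N i) R M) \<and> (\<forall>i < l. N i \<subset> N (Suc i))"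

lemma submodule_chain_refine:
  assumes chain: "submodule_chain R M l N" and i: "i < l"
    and L: "submodule L R M" "N i \<subset> L" "L \<subset> N (Suc i)"
  shows "submodule_chain R M (Suc l) (\<lambda>j. if j \<le> i then N j else if j = Suc i then L else N (j - 1))"
  unfolding submodule_chain_def
proof (intro conjI allI impI)
  fix j assume j: "j < Suc l"
  have lt: "N k \<subset> N (Suc k)" if "k < l" for k using chain that by (simp add: submodule_chain_def)
  consider "j < i" | "j = i" | "j = Suc i" | "Suc i < j" by linarith
  then show "(if j \<le> i then N j else if j = Suc i then L else N (j - 1))
      \<subset> (if Suc j \<le> i then N (Suc j) else if Suc j = Suc i then L else N (Suc j - 1))"
  proof cases
    \<comment> \<open>Past \<open>L\<close> the members have moved up by one index.\<close>
    case 4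
    then show ?thesis using lt[of "j - 1"] j by simp
  qed (use L lt i in auto)
qed (use chain i L(1) in \<open>auto simp: submodule_chain_def\<close>)

lemma finite_length_if_chains_bounded:
  assumes ex: "submodule_chain R M l0 N0"
    and bound: "\<And>l N. submodule_chain R M l N \<Longrightarrow> l \<le> b"
  shows "finite_length R M"
proof -
  define P where "P l \<longleftrightarrow> (\<exists>N. submodule_chain R M l N)" for l
  have P: "P l0" "\<And>l. P l \<Longrightarrow> l \<le> b" using ex bound by (auto simp: P_def)
  define l where "l = Greatest P"
  have "P l" unfolding l_def using P by (rule GreatestI_nat)
  then obtain N where N: "submodule_chain R M l N" by (auto simp: P_def)
  have max: "l' \<le> l" if "submodule_chain R M l' N'" for l' N'
  proof -
    have "P l'" using that by (auto simp: P_def)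
    then show ?thesis unfolding l_def using P(2) by (rule Greatest_le_nat)
  qed
  have "L = N i \<or> L = N (Suc i)"
    if "i < l" "submodule L R M" "N i \<subseteq> L" "L \<subseteq> N (Suc i)" for i L
  proof (rule ccontr)
    assume "\<not> ?thesis"
    then have "N i \<subset> L" "L \<subset> N (Suc i)" using that by auto
    from max[OF submodule_chain_refine[OF N that(1,2) this]] show False by simp
  qed
  then have "composition_series R M l N"
    using N unfolding composition_series_def submodule_chain_def by blast
  then show ?thesis unfolding finite_length_def by blast
qed

context
  fixes n :: nat and f :: "'k::field mpol" and act
  assumes f: "f \<in> polys n" and f0: "f \<noteq> 0" and act: "natural_action n f act"
begin

lemma loc_module_simps:
  "carrier (loc_module n f act) = localization n f" "\<zero>\<^bsub>loc_module n f act\<^esub> = 0"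
  "y \<oplus>\<^bsub>loc_module n f act\<^esub> z = y + z" "P \<odot>\<^bsub>loc_module n f act\<^esub> z = act P z"
  by (simp_all add: loc_module_def)

text \<open>
  Of the action on a submodule only the multiplications and the operators \<open>D\<^sub>t\<^sub>,\<^sub>i\<close> enter the
  growth argument, and these are the same in every natural action.
\<close>

lemma submodule_diff_stable:
  assumes "submodule L (diff_ops n) (loc_module n f act)"
  shows "diff_stable n L"
proof -
  interpret L: submodule L "diff_ops n" "loc_module n f act" by fact
  have sub: "L \<subseteq> localization n f" using L.subset by (simp add: loc_module_simps)
  have closed: "act P z \<in> L" if "P \<in> carrier (diff_ops n)" "z \<in> L" for P z
    using L.smult_closed[OF that] by (simp add: loc_module_simps)
  have mult: "frac_of r * z \<in> L" if "r \<in> polys n" "z \<in> L" for r z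
    using closed[OF mult_op_diff_ops[OF that(1)] that(2)] act sub that
    by (auto simp: natural_action_def)
  have deriv: "hasse_fract t i z \<in> L" if "i < n" "z \<in> L" for t i z
    using closed[OF deriv_op_diff_ops[OF that(1)] that(2)] natural_action_deriv[OF f f0 act that(1)]
      sub that(2) by auto
  have zero: "0 \<in> L" using L.one_closed by (simp add: loc_module_simps)
  have add: "y + z \<in> L" if "y \<in> L" "z \<in> L" for y z
    using L.m_closed[OF that] by (simp add: loc_module_simps)
  have var: "Var i \<in> polys n" if "i < n" for i
    using Var_polys_upto[OF that] by (rule polys_upto_polys)
  show ?thesis
    unfolding diff_stable_def diff_filtration_def
    by (intro conjI allI ballI impI subset_refl zero add mult deriv polys_Const var)
qed

lemma chain_bound:
  obtains b where "\<And>l N. submodule_chain (diff_ops n) (loc_module n f act) l N \<Longrightarrow> l \<le> b"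
proof -
  obtain d where d: "f \<in> polys_upto n d" using f by (rule polys_in_polys_upto)
  have "l \<le> ((4 * n + 1) * (d + 1) + 1) ^ n"
    if chain: "submodule_chain (diff_ops n) (loc_module n f act) l N" for l N
  proof (rule chain_length_bound[OF pole_filtration[OF d f0]])
    show "\<exists>S. finite S \<and> bounded_pole n f s (s * (d + 1)) \<subseteq> kspace.span S \<and>
        card S \<le> (s * (d + 1) + 1) ^ n" for s
      by (rule bounded_pole_dimension[OF d f0])
    show "N l \<subseteq> (\<Union>s. bounded_pole n f s (s * (d + 1)))"
      using pole_filtration_exhaustive[OF d f0] chain
      by (simp add: submodule_chain_def loc_module_simps)
    show "diff_stable n (N i)" if "i \<le> l" for i
      using chain that by (intro submodule_diff_stable) (simp add: submodule_chain_def)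
    show "N i \<subset> N (Suc i)" if "i < l" for i
      using chain that by (simp add: submodule_chain_def)
  qed
  then show ?thesis using that by blast
qed

lemma loc_module_finite_length: "finite_length (diff_ops n) (loc_module n f act)"
proof -
  interpret left_module "diff_ops n" "loc_module n f act"
    using act by (simp add: natural_action_def)
  let ?M = "loc_module n f act"
  have "act P 0 = 0" if "P \<in> carrier (diff_ops n)" for P
  proof -
    have "0 \<in> localization n f"
      using M.zero_closed by (simp add: loc_module_simps)
    then have "act P (0 + 0) = act P 0 + act P 0"
      using smult_r_distr[OF that, of 0 0] by (simp add: loc_module_simps)
    then show ?thesis by (metis add.right_neutral add_left_imp_eq)
  qed
  then have "submodule {\<zero>\<^bsub>?M\<^esub>} (diff_ops n) ?M"
    by (intro submodule.intro submodule_axioms.intro M.add.triv_subgroup[simplified])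
       (auto simp: loc_module_simps)
  moreover have "submodule (carrier ?M) (diff_ops n) ?M"
    by (intro submodule.intro submodule_axioms.intro M.add.subgroup_self[simplified] smult_closed)
  moreover have "frac_of 1 \<in> carrier ?M" "frac_of 1 \<noteq> \<zero>\<^bsub>?M\<^esub>"
    using localization_frac_of[OF f f0 one_polys] by (simp_all add: loc_module_simps frac_of_one)
  then have "{\<zero>\<^bsub>?M\<^esub>} \<subset> carrier ?M" using M.zero_closed by blast
  ultimately have "submodule_chain (diff_ops n) ?M 1
      (\<lambda>i. if i = 0 then {\<zero>\<^bsub>?M\<^esub>} else carrier ?M)"
    by (simp add: submodule_chain_def)
  then show ?thesis
    using chain_bound finite_length_if_chains_bounded by metis
qed

end

theorem theorem1p1:
  fixes n :: nat and f :: "'k::field mpol"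
  assumes "f \<in> polys n" and "f \<noteq> 0"
  shows "(\<exists>act. natural_action n f act) \<and>
         (\<forall>act. natural_action n f act \<longrightarrow> finite_length (diff_ops n) (loc_module n f act))"
  using natural_action_extension_action[OF assms] loc_module_finite_length[OF assms] by blast

end
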